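(* Let $T$ be a tree with $n$ vertices. Then \[ \mathcal{B}_{n-1}=\{d(\mathcal{M},X)\mid \mathcal{M}\in\mathcal{V}_2^*(T^\ell,n-1)\} \] is a reduced Gröbner basis of $I_{n-1}(T,X)$ with respect to the degree lexicographic order.
   Context: A tree is a simple connected graph without cycles. Label the vertices $v_1,\dots,v_n$ and write $x_i=x_{v_i}$. The generalized Laplacian $L(T,X)$ has diagonal entries $x_i$ and off-diagonal entry $-1$ for adjacent vertices, $0$ otherwise; $I_j(T,X)\subseteq\mathbb{Z}[x_1,\dots,x_n]$ is the ideal generated by all $j\times j$ minors of $L(T,X)$. A $2$-matching of a graph (loops allowed) is a set $\mathcal{M}$ of edges such that every vertex is incident to at most two edges of $\mathcal{M}$ (a loop counts twice for incidence but as one edge). $T^\ell$ is $T$ with a loop added at each vertex; $\ell(\mathcal{M})$ is the set of loops in $\mathcal{M}$. A $2$-matching $\mathcal{M}$ of $T^\ell$ is minimal if there is no $2$-matching $\mathcal{M}'$ of $T^\ell$ with $|\mathcal{M}'|=|\mathcal{M}|$ and $\ell(\mathcal{M}')\subsetneq\ell(\mathcal{M})$; $\mathcal{V}_2^*(T^\ell,j)$ is the set of minimal $2$-matchings of size $j$. Components of $\mathcal{M}$ are single loops or paths of $T$; orient each path $w_1\cdots w_{m+1}$ (either direction), with heads $\{w_2,\dots,w_{m+1}\}$ and tails $\{w_1,\dots,w_m\}$, a loop $uu$ having head and tail $u$; $h(\mathcal{M})$, $t(\mathcal{M})$ are the unions of heads, resp. tails. $d(\mathcal{M},X)=\pm\det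 L(T,X)[h(\mathcal{M}),t(\mathcal{M})]$ with the sign making the leading coefficient positive. Degree lexicographic order: $x^\alpha\prec x^\beta$ if $\sum\alpha_i<\sum\beta_i$, or the sums are equal and for the first index $i$ with $\alpha_i\neq\beta_i$ one has $\alpha_i<\beta_i$. For $p\in\mathbb{Z}[x]$, $\mathrm{lp}(p)$, $\mathrm{lc}(p)$, $\mathrm{lt}(p)=\mathrm{lc}(p)\mathrm{lp}(p)$ are its leading power (monomial), coefficient and term. A finite set $B$ of nonzero polynomials in an ideal $I$ is a Gröbner basis of $I$ if $\langle \mathrm{lt}(b)\mid b\in B\rangle=\langle \mathrm{lt}(f)\mid f\in I\rangle$; it is reduced if $\mathrm{lc}(b)=1$ for all $b\in B$ and no nonzero term of any $b_i\in B$ is divisible by $\mathrm{lp}(b_j)$ for $b_j\in B$, $j\neq i$. *)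

theory Defs
  imports Main "HOL-Library.Poly_Mapping" "Jordan_Normal_Form.Determinant"
    "Jordan_Normal_Form.DL_Submatrix"
begin

text \<open>A graph on vertex set {0..<n} is given by a set E of edges, each a 2-element
 subset of {0..<n}. Vertex v_i of the paper is the natural number i-1.\<close>

definition simple_graph :: "nat \<Rightarrow> nat set set \<Rightarrow> bool" where
  "simple_graph n E \<longleftrightarrow> (\<forall>e\<in>E. e \<subseteq> {0..<n} \<and> card e = 2)"

definition adj :: "nat set set \<Rightarrow> nat \<Rightarrow> nat \<Rightarrow> bool" where
  "adj E u v \<longleftrightarrow> {u, v} \<in> E"

definition connected_graph :: "nat \<Rightarrow> nat set set \<Rightarrow> bool" where
  "connected_graph n E \<longleftrightarrow>
     (\<forall>u<n. \<forall>v<n. \<exists>p. p \<noteq> [] \<and> hd p = u \<and> last p = v \<and>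
        (\<forall>i. Suc i < length p \<longrightarrow> adj E (p ! i) (p ! Suc i)))"

definition has_cycle :: "nat set set \<Rightarrow> bool" where
  "has_cycle E \<longleftrightarrow> (\<exists>c. length c \<ge> 3 \<and> distinct c \<and>
        (\<forall>i. Suc i < length c \<longrightarrow> adj E (c ! i) (c ! Suc i)) \<and> adj E (last c) (hd c))"

definition is_tree :: "nat \<Rightarrow> nat set set \<Rightarrow> bool" where
  "is_tree n E \<longleftrightarrow> n \<ge> 1 \<and> simple_graph n E \<and> connected_graph n E \<and> \<not> has_cycle E"

type_synonym monom = "nat \<Rightarrow>\<^sub>0 nat"
type_synonym ipoly = "monom \<Rightarrow>\<^sub>0 int"

definition Var :: "nat \<Rightarrow> ipoly" where
  "Var i = Poly_Mapping.single (Poly_Mapping.single i 1) 1"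

definition mdeg :: "monom \<Rightarrow> nat" where
  "mdeg a = (\<Sum>i\<in>Poly_Mapping.keys a. Poly_Mapping.lookup a i)"

definition deglex_less :: "monom \<Rightarrow> monom \<Rightarrow> bool" where
  "deglex_less a b \<longleftrightarrow> mdeg a < mdeg b \<or>
     (mdeg a = mdeg b \<and> (\<exists>i. (\<forall>j<i. Poly_Mapping.lookup a j = Poly_Mapping.lookup b j) \<and> Poly_Mapping.lookup a i < Poly_Mapping.lookup b i))"

definition lp :: "ipoly \<Rightarrow> monom" where
  "lp p = (THE m. m \<in> Poly_Mapping.keys p \<and> (\<forall>m'\<in>Poly_Mapping.keys p. m' \<noteq> m \<longrightarrow> deglex_less m' m))"

definition lc :: "ipoly \<Rightarrow> int" where
  "lc p = Poly_Mapping.lookup p (lp p)"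

definition lt :: "ipoly \<Rightarrow> ipoly" where
  "lt p = Poly_Mapping.single (lp p) (lc p)"

definition mdvd :: "monom \<Rightarrow> monom \<Rightarrow> bool" where
  "mdvd a b \<longleftrightarrow> (\<forall>i. Poly_Mapping.lookup a i \<le> Poly_Mapping.lookup b i)"

definition ideal_gen :: "ipoly set \<Rightarrow> ipoly set" where
  "ideal_gen S = {p. \<exists>F c. finite F \<and> F \<subseteq> S \<and> p = (\<Sum>s\<in>F. c s * s)}"

definition is_ideal :: "ipoly set \<Rightarrow> bool" where
  "is_ideal I \<longleftrightarrow> ideal_gen I = I"

definition groebner_basis :: "ipoly set \<Rightarrow> ipoly set \<Rightarrow> bool" where
  "groebner_basis B I \<longleftrightarrow> finite B \<and> B \<subseteq> I \<and> 0 \<notin> B \<and>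
     ideal_gen (lt ` B) = ideal_gen (lt ` I)"

definition reduced_groebner_basis :: "ipoly set \<Rightarrow> ipoly set \<Rightarrow> bool" where
  "reduced_groebner_basis B I \<longleftrightarrow> groebner_basis B I \<and>
     (\<forall>b\<in>B. lc b = 1) \<and>
     (\<forall>bi\<in>B. \<forall>bj\<in>B. bj \<noteq> bi \<longrightarrow>
        (\<forall>m\<in>Poly_Mapping.keys bi. \<not> mdvd (lp bj) m))"

definition gen_laplacian :: "nat \<Rightarrow> nat set set \<Rightarrow> ipoly mat" where
  "gen_laplacian n E = mat n n (\<lambda>(i, j). if i = j then Var i else if adj E i j then -1 else 0)"

definition minor :: "nat \<Rightarrow> nat set set \<Rightarrow> nat set \<Rightarrow> nat set \<Rightarrow> ipoly" where
  "minor n E R C = det (submatrix (gen_laplacian n E) R C)"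

definition minor_ideal :: "nat \<Rightarrow> nat set set \<Rightarrow> nat \<Rightarrow> ipoly set" where
  "minor_ideal n E j = ideal_gen {minor n E R C | R C. R \<subseteq> {0..<n} \<and> C \<subseteq> {0..<n} \<and>
      card R = j \<and> card C = j}"

definition loop_edges :: "nat \<Rightarrow> nat set set" where
  "loop_edges n = {{v} | v. v < n}"

definition inc_deg :: "nat set set \<Rightarrow> nat \<Rightarrow> nat" where
  "inc_deg M v = (if {v} \<in> M then 2 else 0) + card {e\<in>M. card e = 2 \<and> v \<in> e}"

definition two_matching :: "nat \<Rightarrow> nat set set \<Rightarrow> nat set set \<Rightarrow> bool" where
  "two_matching n E M \<longleftrightarrow> M \<subseteq> E \<union> loop_edges n \<and> (\<forall>v. inc_deg M v \<le> 2)"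

definition loops_of :: "nat set set \<Rightarrow> nat set set" where
  "loops_of M = {e\<in>M. card e = 1}"

definition minimal_two_matchings :: "nat \<Rightarrow> nat set set \<Rightarrow> nat \<Rightarrow> nat set set set" where
  "minimal_two_matchings n E j = {M. two_matching n E M \<and> card M = j \<and>
     \<not> (\<exists>M'. two_matching n E M' \<and> card M' = card M \<and> loops_of M' \<subset> loops_of M)}"

text \<open>An orientation of the path components of M: each non-loop edge e of M is given a
 direction (tail, head) = (fst (ori e), snd (ori e)), such that every vertex is the tail of
 at most one edge and the head of at most one edge (so every path w_1...w_{m+1} is
 oriented consistently). Heads/tails then are as in the paper.\<close>
definition orientation :: "nat set set \<Rightarrow> (nat set \<Rightarrow> nat \<times> nat) \<Rightarrow> bool" where
  "orientation M ori \<longleftrightarrow>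
     (\<forall>e\<in>M. card e = 2 \<longrightarrow> e = {fst (ori e), snd (ori e)}) \<and>
     inj_on (\<lambda>e. fst (ori e)) {e\<in>M. card e = 2} \<and>
     inj_on (\<lambda>e. snd (ori e)) {e\<in>M. card e = 2}"

definition heads :: "nat set set \<Rightarrow> (nat set \<Rightarrow> nat \<times> nat) \<Rightarrow> nat set" where
  "heads M ori = {snd (ori e) | e. e \<in> M \<and> card e = 2} \<union> {v. {v} \<in> M}"

definition tails :: "nat set set \<Rightarrow> (nat set \<Rightarrow> nat \<times> nat) \<Rightarrow> nat set" where
  "tails M ori = {fst (ori e) | e. e \<in> M \<and> card e = 2} \<union> {v. {v} \<in> M}"

definition normalize_sign :: "ipoly \<Rightarrow> ipoly" where
  "normalize_sign p = (if lc p < 0 then - p else p)"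

definition dM :: "nat \<Rightarrow> nat set set \<Rightarrow> nat set set \<Rightarrow> (nat set \<Rightarrow> nat \<times> nat) \<Rightarrow> ipoly" where
  "dM n E M ori = normalize_sign (minor n E (heads M ori) (tails M ori))"

end

theory Submission
  imports Defs "HOL-Combinatorics.Cycles"
begin

text \<open>
  Expanding a cofactor of \<open>L(T, X)\<close> over permutations and using uniqueness of paths shows that the
  \<open>(n-1)\<close>-minors are, up to sign, the principal minors \<open>\<Delta>(V - P)\<close> for \<open>P\<close> the vertex set of a path. The
  leading monomial of \<open>\<Delta>(S)\<close> is the product of the variables in \<open>S\<close> and all other terms have smaller
  degree. The 2-matchings of size \<open>n-1\<close> are the paths together with loops at all other vertices, and the
  minimal ones belong to the inclusion-maximal paths.

  Buchberger's criterion is not needed. Suppose the leading monomial \<open>\<mu>\<close> of some \<open>f\<close> in the ideal is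
  divisible by no \<open>x\<^sup>V\<^sup>-\<^sup>P\<close>. Then the vertices absent from \<open>\<mu>\<close> do not lie on a common path, so three of them
  lie in different branches \<open>B\<^sub>1, B\<^sub>2, B\<^sub>3\<close> at some vertex \<open>m\<close>. Each permutation contributing to a
  cofactor maps one of these branches to itself, so the ideal is contained in that generated by
  \<open>\<Delta>(B\<^sub>1), \<Delta>(B\<^sub>2), \<Delta>(B\<^sub>3)\<close>. These have coprime leading monomials, so one of the
  products \<open>x\<^sup>B\<close> divides \<open>\<mu>\<close>, a contradiction.
\<close>

abbreviation "lookup \<equiv> Poly_Mapping.lookup"
abbreviation "keys \<equiv> Poly_Mapping.keys"
abbreviation "single \<equiv> Poly_Mapping.single"

section \<open>Ideals\<close>

context
begin

interpretation poly_ideal: Modules.module "(*) :: ipoly \<Rightarrow> ipoly \<Rightarrow> ipoly"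
  by unfold_locales (auto simp: algebra_simps)

text \<open>The ring is a module over itself and its submodules are the ideals, so the closure
  properties of \<open>ideal_gen\<close> are inherited from \<open>span\<close>.\<close>

private lemma ideal_gen_eq_span: "ideal_gen S = poly_ideal.span S"
  unfolding ideal_gen_def poly_ideal.span_explicit by auto

lemma ideal_gen_base: "p \<in> S \<Longrightarrow> p \<in> ideal_gen S"
  and ideal_gen_zero: "0 \<in> ideal_gen S"
  and ideal_gen_add: "p \<in> ideal_gen S \<Longrightarrow> q \<in> ideal_gen S \<Longrightarrow> p + q \<in> ideal_gen S"
  and ideal_gen_minus: "p \<in> ideal_gen S \<Longrightarrow> - p \<in> ideal_gen S"
  and ideal_gen_mult: "p \<in> ideal_gen S \<Longrightarrow> c * p \<in> ideal_gen S"
  and ideal_gen_mono: "S \<subseteq> T \<Longrightarrow> ideal_gen S \<subseteq> ideal_gen T"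
  unfolding ideal_gen_eq_span
  by (auto intro: poly_ideal.span_base poly_ideal.span_zero poly_ideal.span_add
      poly_ideal.span_neg poly_ideal.span_scale dest: poly_ideal.span_mono)

lemma ideal_gen_minimal: "S \<subseteq> ideal_gen T \<Longrightarrow> ideal_gen S \<subseteq> ideal_gen T"
  unfolding ideal_gen_eq_span by (rule poly_ideal.span_minimal) auto

text \<open>Coefficients are indexed by \<open>A\<close> instead of by the generators, so
  \<open>g\<close> may repeat values. In the induction a new multiple of \<open>g i\<close> is
  absorbed into the coefficient at the one index \<open>i\<close>.\<close>

lemma ideal_gen_image:
  assumes "finite A" "p \<in> ideal_gen (g ` A)"
  shows "\<exists>h. p = (\<Sum>i\<in>A. h i * g i)"
proof -
  have "p \<in> poly_ideal.span (g ` A)" using assms by (simp add: ideal_gen_eq_span)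
  then show ?thesis
  proof (induction rule: poly_ideal.span_induct_alt)
    case base
    show ?case by (intro exI[of _ "\<lambda>_. 0"]) simp
  next
    case (step c x y)
    then obtain h i where "y = (\<Sum>i\<in>A. h i * g i)" "i \<in> A" "x = g i" by blast
    then have "c * x + y = (\<Sum>j\<in>A. (if j = i then c * g i else 0) + h j * g j)"
      using assms(1) by (simp add: sum.distrib)
    also have "\<dots> = (\<Sum>j\<in>A. ((if j = i then c else 0) + h j) * g j)"
      by (rule sum.cong) (auto simp: distrib_right)
    finally show ?case by (intro exI[of _ "\<lambda>j. (if j = i then c else 0) + h j"])
  qed
qed

end

lemma poly_eq_sum_single: "(p :: ipoly) = (\<Sum>m\<in>keys p. single m (lookup p m))"
proof (rule poly_mapping_eqI)
  fix k
  have "lookup (\<Sum>m\<in>keys p. single m (lookup p m)) k = (\<Sum>m\<in>keys p. if m = k then lookup p m else 0)"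
    by (simp add: lookup_sum lookup_single when_def)
  then show "lookup p k = lookup (\<Sum>m\<in>keys p. single m (lookup p m)) k"
    by (simp add: in_keys_iff)
qed

section \<open>The degree lexicographic order\<close>

lemma mdeg_eq_sum:
  assumes "finite A" "keys a \<subseteq> A"
  shows "mdeg a = (\<Sum>i\<in>A. lookup a i)"
  unfolding mdeg_def using assms
  by (intro sum.mono_neutral_left) (auto simp: in_keys_iff)

lemma mdeg_add: "mdeg (a + b) = mdeg a + mdeg b"
proof -
  let ?A = "keys a \<union> keys b"
  have "mdeg (a + b) = (\<Sum>i\<in>?A. lookup (a + b) i)"
    by (rule mdeg_eq_sum) (auto simp: keys_add)
  moreover have "mdeg a = (\<Sum>i\<in>?A. lookup a i)" "mdeg b = (\<Sum>i\<in>?A. lookup b i)"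
    by (rule mdeg_eq_sum; auto)+
  ultimately show ?thesis by (simp add: lookup_add sum.distrib)
qed

lemma mdvd_iff: "mdvd a b \<longleftrightarrow> (\<exists>c. b = c + a)"
proof
  assume "mdvd a b"
  then have "b = (b - a) + a"
    by (intro poly_mapping_eqI) (auto simp: mdvd_def lookup_add lookup_minus)
  then show "\<exists>c. b = c + a" by blast
qed (auto simp: mdvd_def lookup_add)

lemma deglex_less_irrefl: "\<not> deglex_less a a"
  by (simp add: deglex_less_def)

lemma deglex_less_total: "a \<noteq> b \<Longrightarrow> deglex_less a b \<or> deglex_less b a"
proof -
  assume "a \<noteq> b"
  then have ex: "\<exists>i. lookup a i \<noteq> lookup b i" by (meson poly_mapping_eqI)
  define i where "i = (LEAST i. lookup a i \<noteq> lookup b i)"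
  have "lookup a i \<noteq> lookup b i" unfolding i_def using ex by (rule LeastI_ex)
  then consider "lookup a i < lookup b i" | "lookup b i < lookup a i" by linarith
  moreover have eq: "\<forall>j<i. lookup a j = lookup b j" unfolding i_def using not_less_Least by blast
  moreover from eq have "\<forall>j<i. lookup b j = lookup a j" by simp
  ultimately show ?thesis unfolding deglex_less_def
    by (cases "mdeg a" "mdeg b" rule: linorder_cases) metis+
qed

lemma deglex_less_trans: "deglex_less a b \<Longrightarrow> deglex_less b c \<Longrightarrow> deglex_less a c"
proof -
  assume ab: "deglex_less a b" and bc: "deglex_less b c"
  show ?thesis
  proof (cases "mdeg a = mdeg b \<and> mdeg b = mdeg c")
    case True
    then obtain i j where
      i: "\<forall>k<i. lookup a k = lookup b k" "lookup a i < lookup b i" and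
      j: "\<forall>k<j. lookup b k = lookup c k" "lookup b j < lookup c j"
      using ab bc unfolding deglex_less_def by auto
    have "\<forall>k<min i j. lookup a k = lookup c k" using i j by auto
    moreover have "lookup a (min i j) < lookup c (min i j)"
      using i j by (cases i j rule: linorder_cases) (auto simp: min_def)
    ultimately show ?thesis using True unfolding deglex_less_def
      by (intro disjI2 conjI exI[of _ "min i j"]) auto
  qed (use ab bc in \<open>auto simp: deglex_less_def\<close>)
qed

lemma deglex_less_asym: "deglex_less a b \<Longrightarrow> \<not> deglex_less b a"
  using deglex_less_irrefl deglex_less_trans by blast

lemma deglex_greatest_exists:
  assumes "finite K" "K \<noteq> {}"
  shows "\<exists>m\<in>K. \<forall>m'\<in>K. m' \<noteq> m \<longrightarrow> deglex_less m' m"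
  using assms
proof (induction K rule: finite_ne_induct)
  case (insert x F)
  then obtain m where m: "m \<in> F" "\<forall>m'\<in>F. m' \<noteq> m \<longrightarrow> deglex_less m' m" by blast
  consider "deglex_less x m" | "deglex_less m x"
    using deglex_less_total insert.hyps m by metis
  then show ?case
  proof cases
    case 2
    have "\<forall>m'\<in>insert x F. m' \<noteq> x \<longrightarrow> deglex_less m' x"
    proof (intro ballI impI)
      fix m' assume "m' \<in> insert x F" "m' \<noteq> x"
      then show "deglex_less m' x"
        using m 2 deglex_less_trans[of m' m x] by (cases "m' = m") auto
    qed
    then show ?thesis by blast
  qed (use m in auto)
qed simp

section \<open>Leading monomials\<close>

lemma lp_eqI:
  assumes "m \<in> keys p" "\<And>m'. m' \<in> keys p \<Longrightarrow> m' \<noteq> m \<Longrightarrow> deglex_less m' m"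
  shows "lp p = m"
  unfolding lp_def
proof (rule the_equality)
  fix l assume "l \<in> keys p \<and> (\<forall>m'\<in>keys p. m' \<noteq> l \<longrightarrow> deglex_less m' l)"
  then show "l = m" using assms(1) assms(2)[of l] deglex_less_asym[of l m] by metis
qed (use assms in auto)

text \<open>A nonzero polynomial has a greatest monomial, so the definite description in
  \<open>lp\<close> is meaningful. The second claim is what the ideal argument uses: there only the
  maximality of the degree of \<open>lp p\<close> matters.\<close>

lemma lp_in_keys:
  assumes "p \<noteq> 0"
  shows "lp p \<in> keys p" and "m \<in> keys p \<Longrightarrow> mdeg m \<le> mdeg (lp p)"
proof -
  have "keys p \<noteq> {}" using assms by simp
  then obtain l where l: "l \<in> keys p" "\<forall>m'\<in>keys p. m' \<noteq> l \<longrightarrow> deglex_less m' l"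
    using deglex_greatest_exists[of "keys p"] by auto
  then have "lp p = l" by (intro lp_eqI) auto
  with l show "lp p \<in> keys p" and "m \<in> keys p \<Longrightarrow> mdeg m \<le> mdeg (lp p)"
    by (auto simp: deglex_less_def)
qed


section \<open>Leading monomials in disjoint variables\<close>

lemma mult_single_eq_sum:
  "(h :: ipoly) * single u 1 = (\<Sum>k\<in>keys h. single (k + u) (lookup h k))"
  by (subst poly_eq_sum_single[of h]) (simp add: sum_distrib_right mult_single)

lemma lookup_mult_single:
  "lookup ((h :: ipoly) * single u 1) m = (\<Sum>k\<in>keys h. if k + u = m then lookup h k else 0)"
  by (simp add: mult_single_eq_sum lookup_sum lookup_single when_def)

lemma lookup_mult_single_add [simp]: "lookup ((h :: ipoly) * single u 1) (k + u) = lookup h k"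
  by (simp add: lookup_mult_single in_keys_iff)

lemma lookup_mult_single_notdvd:
  "\<not> mdvd u m \<Longrightarrow> lookup ((h :: ipoly) * single u 1) m = 0"
  by (auto simp: lookup_mult_single mdvd_iff intro!: sum.neutral)

text \<open>Multivariate division by several polynomials at once. Each \<open>g j\<close> is
  \<open>u j\<close> plus terms of smaller degree, so replacing a monomial divisible by
  \<open>u j\<close> through \<open>g j\<close> produces only terms of smaller degree, and induction
  on a degree bound finishes.\<close>

lemma division:
  fixes g :: "nat \<Rightarrow> ipoly" and u :: "nat \<Rightarrow> monom"
  assumes g: "\<And>j m. j < k \<Longrightarrow> m \<in> keys (g j - single (u j) 1) \<Longrightarrow> mdeg m < mdeg (u j)"
  shows "\<exists>q r. h = (\<Sum>j<k. q j * g j) + r \<and> (\<forall>m\<in>keys r. \<forall>j<k. \<not> mdvd (u j) m)"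
proof -
  define good where "good h \<longleftrightarrow> (\<exists>q r. h = (\<Sum>j<k. q j * g j) + r \<and> 
    (\<forall>m\<in>keys r. \<forall>j<k. \<not> mdvd (u j) m))" for h
  have good0: "good 0"
    unfolding good_def by (intro exI[of _ "\<lambda>_. 0"] exI[of _ 0]) simp
  have good_add: "good (h1 + h2)" if h1: "good h1" and h2: "good h2" for h1 h2
  proof -
    from h1 obtain q1 r1 where 1: "h1 = (\<Sum>j<k. q1 j * g j) + r1"
      "\<forall>m\<in>keys r1. \<forall>j<k. \<not> mdvd (u j) m" unfolding good_def by blast
    from h2 obtain q2 r2 where 2: "h2 = (\<Sum>j<k. q2 j * g j) + r2"
      "\<forall>m\<in>keys r2. \<forall>j<k. \<not> mdvd (u j) m" unfolding good_def by blast
    have "h1 + h2 = (\<Sum>j<k. (q1 j + q2 j) * g j) + (r1 + r2)"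
      unfolding 1 2 by (simp add: sum.distrib algebra_simps)
    moreover have "\<forall>m\<in>keys (r1 + r2). \<forall>j<k. \<not> mdvd (u j) m"
      using 1 2 keys_add[of r1 r2] by blast
    ultimately show ?thesis
      unfolding good_def by (intro exI[of _ "\<lambda>j. q1 j + q2 j"] exI[of _ "r1 + r2"] conjI)
  qed
  have good_sum: "good (\<Sum>x\<in>A. f x)" if "finite A" "\<And>x. x \<in> A \<Longrightarrow> good (f x)"
    for f and A :: "monom set"
    using that by (induction A rule: finite_induct) (auto simp: good0 good_add)
  have "\<forall>h. (\<forall>m\<in>keys h. mdeg m < N) \<longrightarrow> good h" for N
  proof (induction N)
    case 0
    have "h = 0" if "\<forall>m\<in>keys h. mdeg m < 0" for h :: ipoly
      using that by (metis keys_eq_empty all_not_in_conv not_less_zero)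
    then show ?case using good0 by auto
  next
    case (Suc N)
    have single_good: "good (single m c)" if m: "mdeg m < Suc N" for m and c :: int
    proof (cases "\<exists>j<k. mdvd (u j) m")
      case False
      then have "\<forall>m'\<in>keys (single m c). \<forall>j<k. \<not> mdvd (u j) m'" by auto
      then show ?thesis
        unfolding good_def by (intro exI[of _ "\<lambda>_. 0"] exI[of _ "single m c"]) simp
    next
      case True
      then obtain j m' where j: "j < k" "m = m' + u j" unfolding mdvd_iff by blast
      \<comment> \<open>The error made when \<open>single m c\<close> is replaced by
        \<open>single m' c * g j\<close>; it has smaller degree than \<open>m\<close>.\<close>
      let ?t = "- single m' c * (g j - single (u j) 1)"
      have "mdeg x < N" if "x \<in> keys ?t" for x
      proof -
        obtain a b where "x = a + b" "a \<in> keys (- single m' c)" "b \<in> keys (g j - single (u j) 1)"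
          using \<open>x \<in> keys ?t\<close> keys_mult[of "- single m' c" "g j - single (u j) 1"] by blast
        then have "mdeg x < mdeg m' + mdeg (u j)"
          using g[OF j(1)] by (auto simp: mdeg_add split: if_splits)
        then show ?thesis using m j by (simp add: mdeg_add)
      qed
      then have "good ?t" using Suc by blast
      moreover have "good (single m' c * g j)"
        unfolding good_def using j(1)
        by (intro exI[of _ "\<lambda>i. if i = j then single m' c else 0"] exI[of _ 0])
           (simp add: if_distrib[of "\<lambda>x. x * _"] cong: if_cong)
      ultimately have "good (single m' c * g j + ?t)" by (rule good_add[rotated])
      also have "single m' c * g j + ?t = single m c"
        using j by (simp add: algebra_simps mult_single)
      finally show ?thesis .
    qed
    show ?case
    proof (intro allI impI)
      fix h :: ipoly assume "\<forall>m\<in>keys h. mdeg m < Suc N"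
      then have "good (\<Sum>m\<in>keys h. single m (lookup h m))"
        by (intro good_sum single_good) auto
      then show "good h" by (simp flip: poly_eq_sum_single)
    qed
  qed
  \<comment> \<open>The sum of all degrees is a crude bound that also covers the zero
    polynomial.\<close>
  moreover have "\<forall>m\<in>keys h. mdeg m < Suc (\<Sum>m\<in>keys h. mdeg m)"
    by (auto simp: less_Suc_eq_le intro: member_le_sum)
  ultimately show ?thesis unfolding good_def by blast
qed

text \<open>The trivial syzygies \<open>g j * g k = g k * g j\<close> let multiples of an earlier
  generator be moved out of the coefficient of a later one: dividing \<open>h k\<close> by the
  earlier generators leaves the remainder \<open>r\<close> as its new coefficient, and each quotient
  part \<open>q j * g j * g k\<close> is charged to \<open>g j\<close>.\<close>

lemma reduced_representation:
  fixes g :: "nat \<Rightarrow> ipoly" and u :: "nat \<Rightarrow> monom"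
  assumes "\<And>j m. j < k \<Longrightarrow> m \<in> keys (g j - single (u j) 1) \<Longrightarrow> mdeg m < mdeg (u j)"
  shows "\<exists>h'. (\<Sum>i<k. h i * g i) = (\<Sum>i<k. h' i * g i) \<and>
           (\<forall>i<k. \<forall>j<i. \<forall>m\<in>keys (h' i). \<not> mdvd (u j) m)"
  using assms
proof (induction k arbitrary: h)
  case (Suc k)
  obtain q r where qr: "h k = (\<Sum>j<k. q j * g j) + r" "\<forall>m\<in>keys r. \<forall>j<k. \<not> mdvd (u j) m"
    using division[of k g u "h k"] Suc.prems[OF less_SucI] by blast
  obtain h' where h': "(\<Sum>i<k. (h i + q i * g k) * g i) = (\<Sum>i<k. h' i * g i)"
     "\<forall>i<k. \<forall>j<i. \<forall>m\<in>keys (h' i). \<not> mdvd (u j) m"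
    using Suc.IH[of "\<lambda>i. h i + q i * g k", OF Suc.prems[OF less_SucI]] by blast
  have "(\<Sum>i<k. (h i + q i * g k) * g i) = (\<Sum>i<k. h i * g i + (q i * g i) * g k)"
    by (rule sum.cong) (auto simp: algebra_simps)
  then have "(\<Sum>i<Suc k. h i * g i) = (\<Sum>i<k. (h i + q i * g k) * g i) + r * g k"
    by (simp add: qr(1) sum.distrib distrib_right flip: sum_distrib_right)
  also have "\<dots> = (\<Sum>i<Suc k. (h'(k := r)) i * g i)" using h' by simp
  finally show ?case using h' qr by (intro exI[of _ "h'(k := r)"]) (auto simp: less_Suc_eq)
qed simp

text \<open>This replaces the coprimality case of Buchberger's criterion. In a reduced
  representation let \<open>d\<close> be the largest degree of a product of a coefficient monomial
  and its \<open>u i\<close>. One such product of degree \<open>d\<close> survives in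
  \<open>f\<close>, so the top degree of \<open>f\<close> is at least \<open>d\<close>, where only
  multiples of the \<open>u i\<close> contribute.\<close>

lemma top_key_dvd:
  fixes g h :: "nat \<Rightarrow> ipoly" and u :: "nat \<Rightarrow> monom"
  assumes g: "\<And>j m. j < k \<Longrightarrow> m \<in> keys (g j - single (u j) 1) \<Longrightarrow> mdeg m < mdeg (u j)"
    and disj: "\<And>i j. i < k \<Longrightarrow> j < k \<Longrightarrow> i \<noteq> j \<Longrightarrow> keys (u i) \<inter> keys (u j) = {}"
    and f: "f = (\<Sum>i<k. h i * g i)"
    and m: "m \<in> keys f" "\<And>m'. m' \<in> keys f \<Longrightarrow> mdeg m' \<le> mdeg m"
  shows "\<exists>i<k. mdvd (u i) m"
proof -
  obtain h' where f': "f = (\<Sum>i<k. h' i * g i)"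
     and h': "\<And>i j m. i < k \<Longrightarrow> j < i \<Longrightarrow> m \<in> keys (h' i) \<Longrightarrow> \<not> mdvd (u j) m"
    using reduced_representation[of k g u h] g unfolding f by blast
  define D where "D = (\<Union>i<k. (\<lambda>a. (i, a)) ` keys (h' i))"
  define deg where "deg = (\<lambda>(i, a). mdeg a + mdeg (u i))"
  have "finite D" unfolding D_def by simp
  have "D \<noteq> {}"
  proof
    assume "D = {}"
    then have "\<forall>i<k. h' i = 0" unfolding D_def by auto
    then have "f = 0" using f' by simp
    then show False using m by simp
  qed
  define d where "d = Max (deg ` D)"
  have d_ge: "mdeg a + mdeg (u i) \<le> d" if "i < k" "a \<in> keys (h' i)" for i a
  proof -
    have "(i, a) \<in> D" using that by (auto simp: D_def)
    then have "deg (i, a) \<le> d" unfolding d_def using \<open>finite D\<close> by simp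
    then show ?thesis by (simp add: deg_def)
  qed
  \<comment> \<open>The lower terms of the generators cannot reach degree \<open>d\<close>.\<close>
  have tail: "lookup (h' i * (g i - single (u i) 1)) x = 0" if "i < k" "d \<le> mdeg x" for i x
  proof (rule ccontr)
    assume "\<not> ?thesis"
    then have "x \<in> keys (h' i * (g i - single (u i) 1))" by (simp add: in_keys_iff)
    then obtain a b where "x = a + b" "a \<in> keys (h' i)" "b \<in> keys (g i - single (u i) 1)"
      using keys_mult by blast
    then have "mdeg x < mdeg a + mdeg (u i)" using g[OF that(1)] by (auto simp: mdeg_add)
    then show False using d_ge[OF that(1)] that(2) \<open>a \<in> _\<close> by fastforce
  qed
  have lookup_f: "lookup f x = (\<Sum>i<k. lookup (h' i * single (u i) 1) x)" if "d \<le> mdeg x" for x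
  proof -
    have "f = (\<Sum>i<k. h' i * single (u i) 1 + h' i * (g i - single (u i) 1))"
      unfolding f' by (simp add: algebra_simps)
    then show ?thesis using that tail by (simp add: lookup_sum lookup_add)
  qed
  define P where "P i \<longleftrightarrow> i < k \<and> (\<exists>a\<in>keys (h' i). mdeg a + mdeg (u i) = d)" for i
  have "d \<in> deg ` D" unfolding d_def using \<open>finite D\<close> \<open>D \<noteq> {}\<close> by simp
  then have exP: "\<exists>i. P i" unfolding P_def D_def deg_def by auto
  \<comment> \<open>With the least index reaching degree \<open>d\<close>, any term competing with
    \<open>a + u i\<close> belongs to some \<open>j > i\<close>, where the reducedness of
    \<open>h' j\<close> with respect to \<open>u i\<close> applies.\<close>
  define i where "i = (LEAST i. P i)"
  have "P i" unfolding i_def using exP by (rule LeastI_ex)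
  then obtain a where i: "i < k" and a: "a \<in> keys (h' i)" "mdeg a + mdeg (u i) = d"
    unfolding P_def by blast
  have "lookup (h' j * single (u j) 1) (a + u i) = 0" if j: "j < k" "j \<noteq> i" for j
  proof (rule ccontr)
    assume nz: "\<not> ?thesis"
    then obtain b where b: "a + u i = b + u j"
      using lookup_mult_single_notdvd mdvd_iff by metis
    with nz have bk: "b \<in> keys (h' j)" by (simp add: in_keys_iff)
    have "mdeg b + mdeg (u j) = d" using a b by (metis mdeg_add)
    then have "P j" unfolding P_def using j bk by blast
    then have "i < j" using j Least_le[of P j] by (simp add: i_def)
    \<comment> \<open>From \<open>a + u i = b + u j\<close> and the disjoint supports of
      \<open>u i\<close> and \<open>u j\<close>, the monomial \<open>u i\<close> divides
      \<open>b\<close>.\<close>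
    have "lookup (u i) x \<le> lookup b x" for x
    proof (cases "x \<in> keys (u i)")
      case True
      then have "lookup (u j) x = 0" using disj[OF i j(1)] j(2) by (auto simp: in_keys_iff)
      then show ?thesis using arg_cong[OF b, of "\<lambda>y. lookup y x"] by (simp add: lookup_add)
    qed (simp add: in_keys_iff)
    then have "mdvd (u i) b" by (simp add: mdvd_def)
    then show False using h'[OF j(1) \<open>i < j\<close> bk] by blast
  qed
  then have "(\<Sum>j<k. lookup (h' j * single (u j) 1) (a + u i))
      = (\<Sum>j<k. if j = i then lookup (h' i) a else 0)"
    by (intro sum.cong) auto
  then have "lookup f (a + u i) = (\<Sum>j<k. if j = i then lookup (h' i) a else 0)"
    using a lookup_f[of "a + u i"] by (simp add: mdeg_add)
  then have "a + u i \<in> keys f" using i a by (simp add: in_keys_iff)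
  then have "d \<le> mdeg m" using m(2)[of "a + u i"] a by (simp add: mdeg_add)
  then have "(\<Sum>i<k. lookup (h' i * single (u i) 1) m) \<noteq> 0"
    using lookup_f[of m] m by (simp add: in_keys_iff)
  then obtain j where "j < k" "lookup (h' j * single (u j) 1) m \<noteq> 0"
    by (meson lessThan_iff sum.neutral)
  then show ?thesis using lookup_mult_single_notdvd by blast
qed

section \<open>Paths in trees\<close>

lemma has_cycle_successively:
  "has_cycle E \<longleftrightarrow> (\<exists>c. length c \<ge> 3 \<and> distinct c \<and> successively (adj E) c \<and> adj E (last c) (hd c))"
  unfolding has_cycle_def successively_conv_nth by blast

lemma adj_sym: "adj E u v \<Longrightarrow> adj E v u"
  by (simp add: adj_def insert_commute)

lemma successively_adj_rev: "successively (adj E) (rev xs) \<longleftrightarrow> successively (adj E) xs"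
  unfolding successively_rev using adj_sym by (metis successively_mono)

locale finite_tree =
  fixes n :: nat and E :: "nat set set"
  assumes tree: "is_tree n E"
begin

definition is_path :: "nat list \<Rightarrow> bool" where
  "is_path xs \<longleftrightarrow> xs \<noteq> [] \<and> distinct xs \<and> set xs \<subseteq> {0..<n} \<and> successively (adj E) xs"

lemma n_pos: "0 < n" and acyclic: "\<not> has_cycle E"
  using tree by (auto simp: is_tree_def)

lemma edge_subset: "e \<in> E \<Longrightarrow> e \<subseteq> {0..<n}" and card_edge: "e \<in> E \<Longrightarrow> card e = 2"
  using tree by (auto simp: is_tree_def simple_graph_def)

lemma adj_vertices: "adj E u v \<Longrightarrow> u < n \<and> v < n \<and> u \<noteq> v"
  using edge_subset[of "{u, v}"] card_edge[of "{u, v}"] by (auto simp: adj_def)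

lemma path_ends:
  assumes "is_path xs"
  shows "hd xs < n" "last xs < n"
proof -
  have "xs \<noteq> []" "set xs \<subseteq> {0..<n}" using assms by (auto simp: is_path_def)
  then have "hd xs \<in> {0..<n}" "last xs \<in> {0..<n}" by (meson hd_in_set last_in_set subsetD)+
  then show "hd xs < n" "last xs < n" by auto
qed

lemma is_path_rev: "is_path (rev xs) \<longleftrightarrow> is_path xs"
  by (simp add: is_path_def successively_adj_rev del: successively_rev)

lemma walk_vertices:
  "successively (adj E) ws \<Longrightarrow> ws \<noteq> [] \<Longrightarrow> hd ws < n \<Longrightarrow> set ws \<subseteq> {0..<n}"
proof (induction ws)
  case (Cons x ws)
  then show ?case
    using adj_vertices[of x "hd ws"] by (cases "ws = []") (auto simp: successively_Cons)
qed simp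

text \<open>Detours are cut out from the back: if the new first vertex already lies on the path
  found for the rest, the path is started there instead.\<close>

lemma walk_imp_path:
  assumes "successively (adj E) ws" "ws \<noteq> []" "set ws \<subseteq> {0..<n}"
  shows "\<exists>xs. is_path xs \<and> hd xs = hd ws \<and> last xs = last ws \<and> set xs \<subseteq> set ws"
  using assms
proof (induction ws)
  case (Cons x ws)
  show ?case
  proof (cases "ws = []")
    case True
    then show ?thesis using Cons by (intro exI[of _ "[x]"]) (auto simp: is_path_def)
  next
    case False
    then obtain xs where xs: "is_path xs" "hd xs = hd ws" "last xs = last ws" "set xs \<subseteq> set ws"
      using Cons by (auto simp: successively_Cons)
    show ?thesis
    proof (cases "x \<in> set xs")
      case True
      then obtain as bs where "xs = as @ x # bs" by (meson split_list)
      then show ?thesis using xs False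
        by (intro exI[of _ "x # bs"]) (auto simp: is_path_def successively_append_iff)
    next
      case notin: False
      then show ?thesis using xs False Cons.prems
        by (intro exI[of _ "x # xs"]) (auto simp: is_path_def successively_Cons)
    qed
  qed
qed simp

lemma path_exists:
  assumes "u < n" "v < n"
  shows "\<exists>xs. is_path xs \<and> hd xs = u \<and> last xs = v"
proof -
  obtain p where p: "p \<noteq> []" "hd p = u" "last p = v" "successively (adj E) p"
    using tree assms by (auto simp: is_tree_def connected_graph_def successively_conv_nth)
  then show ?thesis using walk_imp_path[of p] walk_vertices[of p] assms by auto
qed

text \<open>After the first vertex where two paths with common ends diverge, the first vertex of one
  that lies on the other closes a cycle.\<close>

lemma walk_unique:
  "\<lbrakk>xs \<noteq> []; ys \<noteq> []; distinct xs; distinct ys; successively (adj E) xs; successively (adj E) ys;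
    hd xs = hd ys; last xs = last ys\<rbrakk> \<Longrightarrow> xs = ys"
proof (induction xs arbitrary: ys)
  case (Cons x xs)
  then obtain ys' where ys: "ys = x # ys'" by (cases ys) auto
  show ?case
  proof (cases "xs = [] \<or> ys' = []")
    case True
    then show ?thesis using Cons.prems ys by (auto split: if_splits)
  next
    case False
    then have ne: "xs \<noteq> []" "ys' \<noteq> []" by auto
    then have last: "last xs = last ys'" using Cons.prems ys by simp
    show ?thesis
    proof (cases "hd xs = hd ys'")
      case True
      then have "xs = ys'"
        using Cons.IH[of ys'] Cons.prems ne last ys by (auto simp: successively_Cons)
      then show ?thesis using ys by simp
    next
      case False
      have "\<exists>z\<in>set xs. z \<in> set ys'" using ne last last_in_set by metis
      then obtain A z B where A: "xs = A @ z # B" "z \<in> set ys'" "\<forall>y\<in>set A. y \<notin> set ys'"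
        using split_list_first_prop[of xs "\<lambda>z. z \<in> set ys'"] by blast
      obtain C D where C: "ys' = C @ z # D" using A(2) by (meson split_list)
      \<comment> \<open>From the point of divergence \<open>x\<close> along \<open>xs\<close> to the
        meeting vertex \<open>z\<close>, and back along the reversed piece of
        \<open>ys\<close>.\<close>
      let ?c = "x # A @ z # rev C"
      \<comment> \<open>If both pieces were empty, the two next vertices would both be
        \<open>z\<close>. Hence the closed walk has at least three vertices.\<close>
      have "A \<noteq> [] \<or> C \<noteq> []" using False A C by auto
      then have "length ?c \<ge> 3" by (auto simp: Suc_le_eq)
      moreover have "distinct ?c" using Cons.prems A C ys by auto
      moreover have "successively (adj E) ?c"
      proof -
        have "successively (adj E) (x # A @ [z])"
          using Cons.prems A by (auto simp: successively_Cons successively_append_iff hd_append split: if_splits)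
        moreover have "successively (adj E) (rev (C @ [z]))"
          unfolding successively_adj_rev
          using Cons.prems C ys by (auto simp: successively_Cons successively_append_iff)
        ultimately show ?thesis
          by (auto simp: successively_Cons successively_append_iff hd_append split: if_splits)
      qed
      moreover have "adj E (last ?c) (hd ?c)"
        using Cons.prems C ys by (cases C) (auto simp: successively_Cons dest: adj_sym)
      ultimately have "has_cycle E" unfolding has_cycle_successively by blast
      then show ?thesis using acyclic by blast
    qed
  qed
qed simp

lemma path_unique:
  "is_path xs \<Longrightarrow> is_path ys \<Longrightarrow> hd xs = hd ys \<Longrightarrow> last xs = last ys \<Longrightarrow> xs = ys"
  unfolding is_path_def using walk_unique by blast

lemma length_path: "is_path xs \<Longrightarrow> length xs = card (set xs)" "is_path xs \<Longrightarrow> length xs \<le> n"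
  using card_mono[of "{0..<n}" "set xs"] by (auto simp: is_path_def distinct_card)

lemma longest_path:
  assumes "is_path ys" "R ys"
  obtains xs where "is_path xs" "R xs" "\<And>zs. is_path zs \<Longrightarrow> R zs \<Longrightarrow> length zs \<le> length xs"
proof -
  have "\<forall>zs. is_path zs \<and> R zs \<longrightarrow> length zs < Suc n" using length_path by (auto simp: less_Suc_eq_le)
  then show ?thesis
    using ex_has_greatest_nat[of "\<lambda>xs. is_path xs \<and> R xs" ys length "Suc n"] assms that by blast
qed

text \<open>The connected component of \<open>a\<close> after deletion of \<open>m\<close>,
  described by walks because those need no distinctness and are easily prolonged.\<close>

definition branch :: "nat \<Rightarrow> nat \<Rightarrow> nat set" where
  "branch m a = {v. \<exists>ws. ws \<noteq> [] \<and> hd ws = a \<and> last ws = v \<and> set ws \<subseteq> {0..<n} - {m} \<and>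
     successively (adj E) ws}"

lemma branch_subset: "branch m a \<subseteq> {0..<n} - {m}"
  unfolding branch_def using last_in_set by blast

lemma branch_self: "a < n \<Longrightarrow> a \<noteq> m \<Longrightarrow> a \<in> branch m a"
  unfolding branch_def by (auto intro!: exI[of _ "[a]"])

lemma branch_step:
  assumes "i \<in> branch m a" "adj E i j" "j \<noteq> m"
  shows "j \<in> branch m a"
proof -
  obtain ws where "ws \<noteq> []" "hd ws = a" "last ws = i" "set ws \<subseteq> {0..<n} - {m}" "successively (adj E) ws"
    using assms unfolding branch_def by blast
  then show ?thesis using assms adj_vertices[of i j] unfolding branch_def
    by (auto intro!: exI[of _ "ws @ [j]"] simp: successively_append_iff)
qed

text \<open>A common vertex would join the two ends of \<open>xs\<close> by a walk avoiding
  \<open>m\<close>. It contains a path, which by uniqueness is \<open>xs\<close>, yet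
  \<open>xs\<close> passes through \<open>m\<close>.\<close>

lemma branch_disjoint:
  assumes xs: "is_path xs" "m \<in> set xs"
  shows "branch m (hd xs) \<inter> branch m (last xs) = {}"
proof (rule ccontr)
  assume "\<not> ?thesis"
  then obtain v as bs where
    as: "as \<noteq> []" "hd as = hd xs" "last as = v" "set as \<subseteq> {0..<n} - {m}" "successively (adj E) as" and
    bs: "bs \<noteq> []" "hd bs = last xs" "last bs = v" "set bs \<subseteq> {0..<n} - {m}" "successively (adj E) bs"
    unfolding branch_def by blast
  \<comment> \<open>The shared vertex \<open>v\<close> is dropped from the reversed second walk so
    that concatenation does not repeat it.\<close>
  obtain cs where cs: "rev bs = v # cs" using bs by (cases "rev bs") (auto simp flip: hd_rev)
  have "successively (adj E) (v # cs)" using bs cs successively_adj_rev by metis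
  then have 1: "successively (adj E) (as @ cs)"
    using as by (auto simp: successively_append_iff successively_Cons)
  have set: "set (as @ cs) \<subseteq> {0..<n} - {m}"
    using as bs(4) arg_cong[OF cs, of set] by auto
  have "last (v # cs) = last xs" using bs cs by (metis last_rev)
  then have last: "last (as @ cs) = last xs" using as by (auto simp: last_append)
  obtain ys where "is_path ys" "hd ys = hd xs" "last ys = last xs" "set ys \<subseteq> set (as @ cs)"
    using walk_imp_path[OF 1] as set last by auto
  then have "ys = xs" using path_unique xs by blast
  then show False using set xs \<open>set ys \<subseteq> _\<close> by auto
qed

text \<open>Take a longest path with both ends in \<open>Z\<close> and a vertex \<open>c\<close> of
  \<open>Z\<close> off it. The path from \<open>c\<close> first meets it at \<open>m\<close>. If
  \<open>m\<close> were an end, going from \<open>c\<close> through \<open>m\<close> to the other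
  end would give a longer path, so \<open>m\<close> separates \<open>c\<close> and both ends into
  three branches.\<close>

lemma tripod_exists:
  assumes Z: "Z \<subseteq> {0..<n}" and no_path: "\<And>xs. is_path xs \<Longrightarrow> \<not> Z \<subseteq> set xs"
  obtains m a b c where "a \<in> Z" "b \<in> Z" "c \<in> Z" "a \<noteq> m" "b \<noteq> m" "c \<noteq> m"
    "branch m a \<inter> branch m b = {}" "branch m c \<inter> branch m a = {}" "branch m c \<inter> branch m b = {}"
proof -
  have "is_path [0]" using n_pos by (simp add: is_path_def)
  then have "Z \<noteq> {}" using no_path by blast
  then obtain z where "z \<in> Z" by blast
  then have "is_path [z]" "hd [z] \<in> Z \<and> last [z] \<in> Z" using Z by (auto simp: is_path_def)
  then obtain xs where xs: "is_path xs" "hd xs \<in> Z" "last xs \<in> Z"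
    and longest: "\<And>zs. is_path zs \<Longrightarrow> hd zs \<in> Z \<Longrightarrow> last zs \<in> Z \<Longrightarrow> length zs \<le> length xs"
    by (rule longest_path[of "[z]" "\<lambda>xs. hd xs \<in> Z \<and> last xs \<in> Z"]) auto
  obtain c where c: "c \<in> Z" "c \<notin> set xs" using no_path[OF xs(1)] by blast
  have xs_ne: "xs \<noteq> []" using xs by (simp add: is_path_def)
  have "hd xs < n" using xs Z by auto
  moreover have "c < n" using c Z by auto
  ultimately obtain ys where ys: "is_path ys" "hd ys = c" "last ys = hd xs"
    using path_exists[of c "hd xs"] by blast
  then have "last ys \<in> set xs" "last ys \<in> set ys"
    using xs_ne hd_in_set[of xs] last_in_set[of ys] by (simp_all add: is_path_def)
  \<comment> \<open>Choosing the first vertex on \<open>xs\<close> keeps \<open>A\<close> disjoint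
    from \<open>xs\<close>, so that \<open>A\<close> can be continued from \<open>m\<close> in both
    directions.\<close>
  then obtain A m B where A: "ys = A @ m # B" "m \<in> set xs" "\<forall>y\<in>set A. y \<notin> set xs"
    using split_list_first_prop[of ys "\<lambda>z. z \<in> set xs"] by blast
  have "A \<noteq> []" using A ys c by auto
  then have hdA: "hd A = c" using A ys by simp
  obtain C D where C: "xs = C @ m # D" using A by (meson split_list)
  have pA: "is_path (A @ [m])" using ys A by (auto simp: is_path_def successively_append_iff successively_Cons)
  have pD: "is_path (A @ m # D)"
    using pA xs(1) C A(3) by (auto simp: is_path_def successively_append_iff successively_Cons)
  have "is_path (rev xs)" using xs is_path_rev by blast
  then have pC: "is_path (A @ m # rev C)"
    using pA C A(3) by (auto simp: is_path_def successively_append_iff successively_Cons)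
  have "C \<noteq> []"
  proof
    assume "C = []"
    then show False using longest[OF pD] \<open>A \<noteq> []\<close> hdA c xs C by auto
  qed
  have "D \<noteq> []"
  proof
    assume "D = []"
    then show False using longest[OF pC] \<open>A \<noteq> []\<close> \<open>C \<noteq> []\<close> hdA c xs C by (auto simp: last_rev)
  qed
  have "branch m (hd xs) \<inter> branch m (last xs) = {}"
    using branch_disjoint[OF xs(1)] C by auto
  moreover have "branch m c \<inter> branch m (hd xs) = {}"
    using branch_disjoint[OF pC, of m] \<open>A \<noteq> []\<close> hdA C \<open>C \<noteq> []\<close> by (simp add: last_rev)
  moreover have "branch m c \<inter> branch m (last xs) = {}"
    using branch_disjoint[OF pD, of m] \<open>A \<noteq> []\<close> hdA C \<open>D \<noteq> []\<close> by simp
  moreover have "hd xs \<noteq> m" "last xs \<noteq> m"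
    using xs(1) C \<open>C \<noteq> []\<close> \<open>D \<noteq> []\<close> by (auto simp: is_path_def)
  moreover have "c \<noteq> m" using c A by auto
  ultimately show ?thesis using that[of "hd xs" "last xs" c m] xs c by blast
qed

end

section \<open>Two-matchings of size one less than the number of vertices\<close>

definition path_edges :: "nat list \<Rightarrow> nat set set" where
  "path_edges xs = (\<lambda>i. {xs ! i, xs ! Suc i}) ` {i. Suc i < length xs}"

lemma path_edges_index_inj:
  assumes "distinct xs" "Suc i < length xs" "Suc j < length xs"
    "{xs ! i, xs ! Suc i} = {xs ! j, xs ! Suc j}"
  shows "i = j"
  using assms by (auto simp: doubleton_eq_iff nth_eq_iff_index_eq)

lemma card_path_edges: "distinct xs \<Longrightarrow> card (path_edges xs) = length xs - 1"
proof -
  assume "distinct xs"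
  then have "inj_on (\<lambda>i. {xs ! i, xs ! Suc i}) {i. Suc i < length xs}"
    using path_edges_index_inj[of xs] by (auto intro!: inj_onI)
  moreover have "{i. Suc i < length xs} = {..<length xs - 1}" by auto
  ultimately show ?thesis unfolding path_edges_def by (simp add: card_image)
qed

lemma path_edges_subset: "e \<in> path_edges xs \<Longrightarrow> e \<subseteq> set xs"
  by (auto simp: path_edges_def)

lemma finite_path_edges: "finite (path_edges xs)"
  using finite_subset[of "path_edges xs" "Pow (set xs)"] path_edges_subset by auto

lemma path_edges_at_vertex:
  assumes "distinct xs" "i < length xs"
  shows "card {e \<in> path_edges xs. xs ! i \<in> e} \<le> 2"
proof -
  have "{e \<in> path_edges xs. xs ! i \<in> e} \<subseteq> {{xs ! (i - 1), xs ! i}, {xs ! i, xs ! Suc i}}"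
    using assms by (auto simp: path_edges_def nth_eq_iff_index_eq)
  then have "card {e \<in> path_edges xs. xs ! i \<in> e} \<le> card {{xs ! (i - 1), xs ! i}, {xs ! i, xs ! Suc i}}"
    by (rule card_mono[rotated]) simp
  also have "\<dots> \<le> 2" by (simp add: card_insert_if)
  finally show ?thesis .
qed

section \<open>Edge sets of maximum degree two in a tree\<close>

context finite_tree
begin

text \<open>One-vertex paths are included: they give the matchings consisting of loops at all
  vertices but one.\<close>

definition matching_of :: "nat list \<Rightarrow> nat set set" where
  "matching_of xs = path_edges xs \<union> {{v} | v. v < n \<and> v \<notin> set xs}"

lemma finite_E: "finite E"
  using finite_subset[of E "Pow {0..<n}"] edge_subset by auto

text \<open>An edge between two non-consecutive vertices would close the segment between them to a
  cycle.\<close>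

lemma chord_of_path:
  assumes "distinct xs" "successively (adj E) xs" "i < j" "j < length xs" "{xs ! i, xs ! j} \<in> E"
  shows "j = Suc i"
proof (rule ccontr)
  assume "j \<noteq> Suc i"
  define c where "c = take (Suc j - i) (drop i xs)"
  have len: "length c = Suc j - i" using assms by (simp add: c_def)
  then have "length c \<ge> 3" using assms \<open>j \<noteq> Suc i\<close> by simp
  moreover have "distinct c" using assms by (simp add: c_def)
  moreover have nth: "c ! k = xs ! (i + k)" if "k < length c" for k
    using that len assms by (simp add: c_def)
  then have "successively (adj E) c"
    using assms len by (auto simp: successively_conv_nth)
  moreover have "c \<noteq> []" using \<open>length c \<ge> 3\<close> by auto
  then have "hd c = xs ! i" "last c = xs ! j"
    using nth[of 0] nth[of "j - i"] len assms(3) by (simp_all add: hd_conv_nth last_conv_nth)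
  then have "adj E (last c) (hd c)" using assms by (simp add: adj_def insert_commute)
  ultimately show False using acyclic unfolding has_cycle_successively by blast
qed

text \<open>An edge of \<open>F\<close> leaving the longest path would extend it if it started at an
  end, and would be a third edge at its vertex if it started inside. An edge with both ends on the
  path is no chord, since the tree has no cycles.\<close>

lemma maximal_path_edges:
  assumes F: "F \<subseteq> E" "\<And>e. e \<in> F \<Longrightarrow> e \<subseteq> P" "\<And>v. card {e\<in>F. v \<in> e} \<le> 2"
    and xs: "distinct xs" "set xs \<subseteq> P" "successively (adj F) xs"
    and longest: "\<And>ys. ys \<noteq> [] \<Longrightarrow> distinct ys \<Longrightarrow> set ys \<subseteq> P \<Longrightarrow> successively (adj F) ys \<Longrightarrow>
      length ys \<le> length xs"
    and e: "e \<in> F" "x \<in> e" "x \<in> set xs"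
  shows "e \<in> path_edges xs"
proof -
  have finF: "finite F" using F finite_E finite_subset by blast
  obtain y where y: "e = {x, y}" "x \<noteq> y"
    using card_edge[of e] e F(1) by (auto simp: card_2_iff doubleton_eq_iff)
  have xy: "adj F x y" "adj F y x" using e y by (auto simp: adj_def insert_commute)
  have "y \<in> P" using F(2)[OF e(1)] y by auto
  obtain i where i: "i < length xs" "x = xs ! i" using e by (metis in_set_conv_nth)
  have sE: "successively (adj E) xs"
    using xs(3) by (rule successively_mono) (use F in \<open>auto simp: adj_def\<close>)
  have "y \<in> set xs"
  proof (rule ccontr)
    assume ny: "y \<notin> set xs"
    have "i \<noteq> 0"
    proof
      assume "i = 0"
      then have "hd xs = x" using i by (auto simp: hd_conv_nth)
      then show False
        using longest[of "y # xs"] ny \<open>y \<in> P\<close> xs xy by (auto simp: successively_Cons)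
    qed
    have "Suc i < length xs"
    proof (rule ccontr)
      assume "\<not> Suc i < length xs"
      then have "length xs = Suc i" using i by simp
      then have "last xs = x" using i by (cases "xs = []") (auto simp: last_conv_nth)
      then show False
        using longest[of "xs @ [y]"] ny \<open>y \<in> P\<close> xs xy by (auto simp: successively_append_iff)
    qed
    then have nb: "adj F (xs ! (i - 1)) x" "adj F x (xs ! Suc i)"
      using xs(3) i \<open>i \<noteq> 0\<close> by (auto simp: successively_conv_nth dest: spec[of _ "i - 1"])
    have "xs ! (i - 1) \<noteq> xs ! Suc i" "xs ! (i - 1) \<noteq> x" "xs ! Suc i \<noteq> x"
      using xs(1) \<open>Suc i < length xs\<close> i \<open>i \<noteq> 0\<close>
      by (auto simp: nth_eq_iff_index_eq)
    moreover have "xs ! (i - 1) \<noteq> y" "xs ! Suc i \<noteq> y" using ny \<open>Suc i < length xs\<close> by auto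
    \<comment> \<open>The two neighbours on the path and \<open>y\<close> give three different edges
      at \<open>x\<close>.\<close>
    ultimately have "card {{xs ! (i - 1), x}, {x, xs ! Suc i}, {x, y}} = 3"
      by (auto simp: card_insert_if doubleton_eq_iff)
    moreover have "{{xs ! (i - 1), x}, {x, xs ! Suc i}, {x, y}} \<subseteq> {e\<in>F. x \<in> e}"
      using nb xy by (auto simp: adj_def)
    then have "card {{xs ! (i - 1), x}, {x, xs ! Suc i}, {x, y}} \<le> card {e\<in>F. x \<in> e}"
      using finF by (intro card_mono) auto
    ultimately show False using F(3)[of x] by simp
  qed
  then obtain j where j: "j < length xs" "y = xs ! j" by (metis in_set_conv_nth)
  have "{x, y} \<in> E" "{y, x} \<in> E" using F e y by (auto simp: insert_commute)
  then have "j = Suc i \<or> i = Suc j"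
    using chord_of_path[OF xs(1) sE, of i j] chord_of_path[OF xs(1) sE, of j i] i j y(2)
    by (cases i j rule: linorder_cases) auto
  then show ?thesis using i j y by (auto simp: path_edges_def insert_commute)
qed

text \<open>\<open>F\<close> is a disjoint union of paths covering \<open>P\<close> (isolated
  vertices included), each with one vertex more than edges, so \<open>card P - card F\<close> counts
  the components and equals one exactly for a single path. The induction splits off a longest
  path.\<close>

lemma path_cover:
  assumes "finite P" "P \<noteq> {}" "F \<subseteq> E" "\<And>e. e \<in> F \<Longrightarrow> e \<subseteq> P" "\<And>v. card {e\<in>F. v \<in> e} \<le> 2"
  shows "card F < card P \<and>
    (Suc (card F) = card P \<longrightarrow> (\<exists>xs. distinct xs \<and> set xs = P \<and> F = path_edges xs))"
  using assms
proof (induction "card P" arbitrary: P F rule: less_induct)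
  case less
  have finF: "finite F" using less.prems finite_E finite_subset by blast
  define Q where "Q ys \<longleftrightarrow> ys \<noteq> [] \<and> distinct ys \<and> set ys \<subseteq> P \<and> successively (adj F) ys" for ys
  obtain p where "p \<in> P" using less.prems by blast
  then have "Q [p]" by (simp add: Q_def)
  moreover have "\<forall>ys. Q ys \<longrightarrow> length ys < Suc (card P)"
    using less.prems(1) card_mono[of P] by (auto simp: Q_def less_Suc_eq_le distinct_card[symmetric])
  ultimately obtain xs where Qxs: "Q xs" and longest: "\<And>ys. Q ys \<Longrightarrow> length ys \<le> length xs"
    using ex_has_greatest_nat[of Q "[p]" length "Suc (card P)"] by blast
  have xs: "xs \<noteq> []" "distinct xs" "set xs \<subseteq> P" "successively (adj F) xs"
    using Qxs by (auto simp: Q_def)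
  have edges: "e \<in> path_edges xs" if "e \<in> F" "x \<in> e" "x \<in> set xs" for e x
    using maximal_path_edges[OF less.prems(3-5) xs(2-4) _ that] longest by (auto simp: Q_def)
  have sub: "path_edges xs \<subseteq> F"
    using xs(4) by (auto simp: path_edges_def successively_conv_nth adj_def)
  let ?F' = "F - path_edges xs" and ?P' = "P - set xs"
  have cardF: "card F = card ?F' + (length xs - 1)"
    using card_Diff_subset[OF finite_path_edges sub] card_mono[OF finF sub]
    by (simp add: card_path_edges[OF xs(2)])
  have cardP: "card P = card ?P' + length xs"
    using card_Diff_subset[OF _ xs(3)] card_mono[OF less.prems(1) xs(3)]
    by (simp add: distinct_card[OF xs(2)])
  have F': "e \<subseteq> ?P'" if "e \<in> ?F'" for e using that less.prems(4) edges by blast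
  have len: "length xs > 0" using xs by simp
  show ?case
  proof (cases "?P' = {}")
    case True
    have "?F' = {}"
    proof (rule ccontr)
      assume "?F' \<noteq> {}"
      then obtain e where "e \<in> ?F'" by blast
      then have "e = {}" "card e = 2" using F'[of e] True card_edge[of e] less.prems(3) by auto
      then show False by simp
    qed
    then have "F = path_edges xs" using sub by blast
    moreover have "set xs = P" using True xs by blast
    ultimately show ?thesis using card_path_edges[OF xs(2)] cardP len xs(2) by auto
  next
    case False
    have deg: "card {e\<in>?F'. v \<in> e} \<le> 2" for v
      by (rule order_trans[OF card_mono less.prems(5)[of v]]) (use finF in auto)
    have "card ?F' < card ?P'"
      using cardP len less.prems(1,3) False F' deg
      by (intro less.hyps[of ?P' ?F', THEN conjunct1]) (blast | simp)+
    \<comment> \<open>The path accounts for one in the difference \<open>card P - card F\<close> and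
      the nonempty rest for at least one more, so the equality case cannot occur.\<close>
    then show ?thesis using cardF cardP len by linarith
  qed
qed

section \<open>Two-matchings and paths\<close>

lemma card_matching_of: "is_path xs \<Longrightarrow> card (matching_of xs) = n - 1"
proof -
  assume xs: "is_path xs"
  have "{{v} | v. v < n \<and> v \<notin> set xs} = (\<lambda>v. {v}) ` ({0..<n} - set xs)" by auto
  then have "card {{v} | v. v < n \<and> v \<notin> set xs} = n - length xs"
    using xs by (simp add: card_image card_Diff_subset is_path_def distinct_card)
  moreover have "path_edges xs \<inter> {{v} | v. v < n \<and> v \<notin> set xs} = {}"
    using path_edges_subset by fastforce
  moreover have "finite {{v} | v. v < n \<and> v \<notin> set xs}" by simp
  ultimately have "card (matching_of xs) = (length xs - 1) + (n - length xs)"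
    unfolding matching_of_def using xs finite_path_edges
    by (simp add: card_Un_disjoint card_path_edges is_path_def)
  moreover have "length xs \<le> n" using xs by (rule length_path)
  moreover have "length xs > 0" using xs by (simp add: is_path_def)
  ultimately show ?thesis by simp
qed

lemma path_edges_in_E: "is_path xs \<Longrightarrow> path_edges xs \<subseteq> E"
  by (auto simp: is_path_def path_edges_def successively_conv_nth adj_def)

lemma edges_matching_of: "is_path xs \<Longrightarrow> {e \<in> matching_of xs. card e = 2} = path_edges xs"
  using path_edges_in_E card_edge by (auto simp: matching_of_def)

lemma singleton_in_matching_of: "is_path xs \<Longrightarrow> {v} \<in> matching_of xs \<longleftrightarrow> v < n \<and> v \<notin> set xs"
  using path_edges_in_E card_edge[of "{v}"] by (auto simp: matching_of_def)

lemma loops_matching_of: "is_path xs \<Longrightarrow> loops_of (matching_of xs) = (\<lambda>v. {v}) ` ({0..<n} - set xs)"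
  using path_edges_in_E card_edge by (fastforce simp: matching_of_def loops_of_def)

lemma two_matching_matching_of:
  assumes xs: "is_path xs"
  shows "two_matching n E (matching_of xs)"
proof -
  have "inc_deg (matching_of xs) v \<le> 2" for v
  proof -
    have eq: "{e \<in> matching_of xs. card e = 2 \<and> v \<in> e} = {e \<in> path_edges xs. v \<in> e}"
      using edges_matching_of[OF xs] by blast
    show ?thesis
    proof (cases "v \<in> set xs")
      case True
      then obtain i where "i < length xs" "v = xs ! i" by (metis in_set_conv_nth)
      then show ?thesis
        using True path_edges_at_vertex[of xs i] xs singleton_in_matching_of[OF xs, of v]
        unfolding inc_deg_def eq by (simp add: is_path_def)
    next
      case False
      then have "{e \<in> path_edges xs. v \<in> e} = {}" using path_edges_subset by blast
      then have "card {e \<in> path_edges xs. v \<in> e} = 0" by (simp only: card.empty)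
      then show ?thesis unfolding inc_deg_def eq by simp
    qed
  qed
  moreover have "matching_of xs \<subseteq> E \<union> loop_edges n"
    using path_edges_in_E[OF xs] by (auto simp: matching_of_def loop_edges_def)
  ultimately show ?thesis by (simp add: two_matching_def)
qed

text \<open>A loop exhausts the degree of its vertex, so the proper edges live on the set of
  vertices without a loop. The size \<open>n - 1\<close> leaves exactly one edge less than there are
  such vertices, which is the equality case of \<open>path_cover\<close>.\<close>

lemma two_matching_imp_path:
  assumes M: "two_matching n E M" "card M = n - 1"
  shows "\<exists>xs. is_path xs \<and> M = matching_of xs"
proof -
  define F where "F = {e\<in>M. card e = 2}"
  define U where "U = {v. {v} \<in> M}"
  have sub: "M \<subseteq> E \<union> loop_edges n" and deg: "\<And>v. inc_deg M v \<le> 2"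
    using M by (auto simp: two_matching_def)
  have finM: "finite M" using sub finite_E by (auto simp: loop_edges_def intro: finite_subset)
  have FE: "F \<subseteq> E" using sub by (auto simp: F_def loop_edges_def)
  have UV: "U \<subseteq> {0..<n}"
    using sub edge_subset by (fastforce simp: U_def loop_edges_def)
  have finF: "finite F" using finM by (simp add: F_def)
  have MFU: "M = F \<union> (\<lambda>v. {v}) ` U"
    using sub card_edge by (fastforce simp: F_def U_def loop_edges_def)
  have "F \<inter> (\<lambda>v. {v}) ` U = {}" by (auto simp: F_def)
  then have cardM: "card M = card F + card U"
    using finF finite_subset[OF UV] MFU by (metis card_Un_disjoint card_image finite_atLeastLessThan
        finite_imageI inj_on_def the_elem_eq)
  have disj: "v \<notin> e" if "e \<in> F" "v \<in> U" for e v
  proof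
    assume "v \<in> e"
    then have "{e \<in> M. card e = 2 \<and> v \<in> e} \<noteq> {}" using that by (auto simp: F_def)
    then have "card {e \<in> M. card e = 2 \<and> v \<in> e} > 0" using finM by (simp add: card_gt_0_iff)
    then show False using deg[of v] that by (simp add: inc_deg_def U_def)
  qed
  let ?P = "{0..<n} - U"
  have FP: "e \<subseteq> ?P" if "e \<in> F" for e using that disj edge_subset[of e] FE by blast
  have degF: "card {e\<in>F. v \<in> e} \<le> 2" for v
  proof -
    have "{e\<in>F. v \<in> e} = {e \<in> M. card e = 2 \<and> v \<in> e}" by (auto simp: F_def)
    then show ?thesis using deg[of v] by (simp add: inc_deg_def)
  qed
  have cardP: "card ?P = n - card U" "card U \<le> n"
    using UV card_mono[OF _ UV] by (auto simp: card_Diff_subset finite_subset)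
  \<comment> \<open>Loops at all \<open>n\<close> vertices would already exceed the size
    \<open>n - 1\<close>.\<close>
  have "?P \<noteq> {}"
  proof
    assume "?P = {}"
    then have "card U = n" using UV by (metis Diff_eq_empty_iff card_atLeastLessThan diff_zero subset_antisym)
    then show False using cardM M n_pos by simp
  qed
  then have "card ?P > 0" by (simp add: card_gt_0_iff)
  then have "Suc (card F) = card ?P" using cardM M cardP by linarith
  then obtain xs where xs: "distinct xs" "set xs = ?P" "F = path_edges xs"
    using path_cover[OF _ \<open>?P \<noteq> {}\<close> FE FP degF] by auto
  have "is_path xs"
    using xs \<open>?P \<noteq> {}\<close> FE by (auto simp: is_path_def successively_conv_nth adj_def path_edges_def)
  moreover have "M = matching_of xs"
    unfolding matching_of_def MFU xs(2) xs(3)[symmetric] using UV by auto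
  ultimately show ?thesis by blast
qed

text \<open>Loops sit exactly off the path, so fewer loops mean a larger vertex set; by
  \<open>two_matching_imp_path\<close> every competing matching comes from a path as well.\<close>

lemma minimal_matching_of_iff:
  assumes xs: "is_path xs"
  shows "matching_of xs \<in> minimal_two_matchings n E (n - 1) \<longleftrightarrow> 
    (\<forall>ys. is_path ys \<longrightarrow> \<not> set xs \<subset> set ys)"
proof -
  have sub: "loops_of (matching_of ys) \<subset> loops_of (matching_of xs) \<longleftrightarrow> set xs \<subset> set ys"
    if "is_path ys" for ys
  proof -
    have "loops_of (matching_of ys) \<subset> loops_of (matching_of xs) \<longleftrightarrow> 
      {0..<n} - set ys \<subset> {0..<n} - set xs"
      unfolding loops_matching_of[OF that] loops_matching_of[OF xs]
      by (simp add: psubset_eq inj_image_subset_iff inj_image_eq_iff)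
    also have "\<dots> \<longleftrightarrow> set xs \<subset> set ys" using xs that by (auto simp: is_path_def)
    finally show ?thesis .
  qed
  have "(\<exists>M'. two_matching n E M' \<and> card M' = n - 1 \<and> loops_of M' \<subset> loops_of (matching_of xs)) \<longleftrightarrow>
      (\<exists>ys. is_path ys \<and> set xs \<subset> set ys)" (is "?A \<longleftrightarrow> ?B")
  proof
    assume ?A
    then obtain M' where M': "two_matching n E M'" "card M' = n - 1"
      "loops_of M' \<subset> loops_of (matching_of xs)" by blast
    then obtain ys where "is_path ys" "M' = matching_of ys" using two_matching_imp_path by blast
    then show ?B using M'(3) sub by blast
  next
    assume ?B
    then obtain ys where ys: "is_path ys" "set xs \<subset> set ys" by blast
    then have "loops_of (matching_of ys) \<subset> loops_of (matching_of xs)" using sub by blast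
    then show ?A using ys two_matching_matching_of card_matching_of by blast
  qed
  then show ?thesis
    unfolding minimal_two_matchings_def mem_Collect_eq card_matching_of[OF xs]
    using two_matching_matching_of[OF xs] by blast
qed

text \<open>The direction of the first edge propagates along the path, since no vertex is the head
  of two edges. Then only the first vertex is not a head and only the last is not a tail; for a
  one-vertex path both are that vertex.\<close>

lemma orientation_forward:
  assumes xs: "is_path xs" and ori: "orientation (matching_of xs) ori"
    and first: "Suc 0 < length xs \<Longrightarrow> ori {xs ! 0, xs ! Suc 0} = (xs ! 0, xs ! Suc 0)"
  shows "heads (matching_of xs) ori = {0..<n} - {hd xs} \<and> tails (matching_of xs) ori = {0..<n} - {last xs}"
proof -
  have ne: "xs \<noteq> []" and dist: "distinct xs" and sub: "set xs \<subseteq> {0..<n}"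
    using xs by (auto simp: is_path_def)
  have in2: "{xs ! i, xs ! Suc i} \<in> {e \<in> matching_of xs. card e = 2}" if "Suc i < length xs" for i
    unfolding edges_matching_of[OF xs] using that by (auto simp: path_edges_def)
  have inj: "inj_on (\<lambda>e. snd (ori e)) {e \<in> matching_of xs. card e = 2}"
    and dir: "\<And>e. e \<in> matching_of xs \<Longrightarrow> card e = 2 \<Longrightarrow> e = {fst (ori e), snd (ori e)}"
    using ori by (auto simp: orientation_def)
  have fwd: "ori {xs ! i, xs ! Suc i} = (xs ! i, xs ! Suc i)" if "Suc i < length xs" for i
    using that
  proof (induction i)
    case (Suc i)
    let ?e = "{xs ! Suc i, xs ! Suc (Suc i)}" and ?d = "{xs ! i, xs ! Suc i}"
    have "?e \<noteq> ?d" using path_edges_index_inj[OF dist, of "Suc i" i] Suc.prems by auto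
    \<comment> \<open>The shared vertex is already the head of the preceding edge, so it must be the
      tail of this one.\<close>
    then have "snd (ori ?e) \<noteq> snd (ori ?d)"
      using inj in2[of i] in2[of "Suc i"] Suc.prems by (auto dest: inj_onD)
    moreover have "snd (ori ?d) = xs ! Suc i" using Suc by simp
    moreover have "?e = {fst (ori ?e), snd (ori ?e)}" using dir in2[OF Suc.prems] by blast
    ultimately have "fst (ori ?e) = xs ! Suc i \<and> snd (ori ?e) = xs ! Suc (Suc i)"
      by (metis doubleton_eq_iff)
    then show ?case by (metis prod.collapse)
  qed (use first in auto)
  have path2: "(\<exists>e. e \<in> matching_of xs \<and> card e = 2 \<and> v = f (ori e)) \<longleftrightarrow>
    (\<exists>i. Suc i < length xs \<and> v = f (xs ! i, xs ! Suc i))" for v and f :: "nat \<times> nat \<Rightarrow> nat"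
  proof -
    have "(\<exists>e. e \<in> matching_of xs \<and> card e = 2 \<and> v = f (ori e)) \<longleftrightarrow> (\<exists>e\<in>path_edges xs. v = f (ori e))"
      using edges_matching_of[OF xs] by blast
    then show ?thesis using fwd by (auto simp: path_edges_def)
  qed
  have hd: "(\<exists>i. Suc i < length xs \<and> v = xs ! Suc i) \<longleftrightarrow> v \<in> set xs \<and> v \<noteq> hd xs" for v
  proof
    assume "\<exists>i. Suc i < length xs \<and> v = xs ! Suc i"
    then show "v \<in> set xs \<and> v \<noteq> hd xs"
      using dist ne by (auto simp: hd_conv_nth nth_eq_iff_index_eq)
  next
    assume v: "v \<in> set xs \<and> v \<noteq> hd xs"
    then obtain i where "i < length xs" "v = xs ! i" by (metis in_set_conv_nth)
    then show "\<exists>i. Suc i < length xs \<and> v = xs ! Suc i"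
      using v ne by (cases i) (auto simp: hd_conv_nth)
  qed
  have last: "(\<exists>i. Suc i < length xs \<and> v = xs ! i) \<longleftrightarrow> v \<in> set xs \<and> v \<noteq> last xs" for v
  proof
    assume "\<exists>i. Suc i < length xs \<and> v = xs ! i"
    then show "v \<in> set xs \<and> v \<noteq> last xs"
      using dist ne by (auto simp: last_conv_nth nth_eq_iff_index_eq)
  next
    assume v: "v \<in> set xs \<and> v \<noteq> last xs"
    then obtain i where i: "i < length xs" "v = xs ! i" by (metis in_set_conv_nth)
    then have "i \<noteq> length xs - 1" using v ne by (auto simp: last_conv_nth)
    then show "\<exists>i. Suc i < length xs \<and> v = xs ! i"
      using i by (intro exI[of _ i]) auto
  qed
  have "v \<in> heads (matching_of xs) ori \<longleftrightarrow> v \<in> {0..<n} - {hd xs}" for v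
    using hd[of v] path2[of v snd] sub ne hd_in_set[OF ne]
    by (auto simp: heads_def singleton_in_matching_of[OF xs])
  moreover have "v \<in> tails (matching_of xs) ori \<longleftrightarrow> v \<in> {0..<n} - {last xs}" for v
    using last[of v] path2[of v fst] sub ne last_in_set[OF ne]
    by (auto simp: tails_def singleton_in_matching_of[OF xs])
  ultimately show ?thesis by blast
qed

text \<open>The first edge points forward or backward. In the backward case all pairs are swapped,
  which exchanges heads and tails, and \<open>ys\<close> is the reversed path.\<close>

lemma heads_tails_matching_of:
  assumes xs: "is_path xs" and ori: "orientation (matching_of xs) ori"
  shows "\<exists>ys. is_path ys \<and> set ys = set xs \<and>
    heads (matching_of xs) ori = {0..<n} - {hd ys} \<and> tails (matching_of xs) ori = {0..<n} - {last ys}"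
proof -
  let ?M = "matching_of xs"
  consider "Suc 0 < length xs \<Longrightarrow> ori {xs ! 0, xs ! Suc 0} = (xs ! 0, xs ! Suc 0)"
    | "Suc 0 < length xs" "ori {xs ! 0, xs ! Suc 0} = (xs ! Suc 0, xs ! 0)"
  proof (cases "Suc 0 < length xs")
    case True
    let ?e = "{xs ! 0, xs ! Suc 0}"
    have "?e \<in> {e \<in> ?M. card e = 2}"
      unfolding edges_matching_of[OF xs] using True by (auto simp: path_edges_def)
    then have "?e = {fst (ori ?e), snd (ori ?e)}" using ori by (auto simp: orientation_def)
    then have "ori ?e = (xs ! 0, xs ! Suc 0) \<or> ori ?e = (xs ! Suc 0, xs ! 0)"
      by (metis doubleton_eq_iff prod.collapse)
    then show ?thesis using that True by blast
  qed (use that in blast)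
  then show ?thesis
  proof cases
    case 1
    then show ?thesis using orientation_forward[OF xs ori] xs by blast
  next
    case 2
    let ?ori = "prod.swap \<circ> ori"
    have "orientation ?M ?ori" using ori by (auto simp: orientation_def insert_commute)
    then have "heads ?M ?ori = {0..<n} - {hd xs} \<and> tails ?M ?ori = {0..<n} - {last xs}"
      using orientation_forward[OF xs, of ?ori] 2 by simp
    moreover have "heads ?M ?ori = tails ?M ori" "tails ?M ?ori = heads ?M ori"
      by (auto simp: heads_def tails_def)
    moreover have "hd (rev xs) = last xs" "last (rev xs) = hd xs"
      by (auto simp: hd_rev last_rev)
    ultimately show ?thesis using xs is_path_rev by (intro exI[of _ "rev xs"]) auto
  qed
qed

lemma orientation_exists:
  assumes xs: "is_path xs"
  shows "\<exists>ori. orientation (matching_of xs) ori"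
proof -
  \<comment> \<open>The position of an edge on the path, unique because the vertices are distinct;
    it lets every edge point towards the end of the list.\<close>
  define idx where "idx e = (THE i. Suc i < length xs \<and> e = {xs ! i, xs ! Suc i})" for e
  have dist: "distinct xs" using xs by (simp add: is_path_def)
  have idx: "idx {xs ! i, xs ! Suc i} = i" if "Suc i < length xs" for i
    unfolding idx_def using that path_edges_index_inj[OF dist] by (intro the_equality) blast+
  define ori where "ori e = (xs ! idx e, xs ! Suc (idx e))" for e
  have "orientation (matching_of xs) ori"
    using dist unfolding orientation_def edges_matching_of[OF xs]
    by (auto simp: path_edges_def ori_def idx inj_on_def nth_eq_iff_index_eq
        dest!: equalityD1[OF edges_matching_of[OF xs], THEN subsetD, OF CollectI, OF conjI])
  then show ?thesis by blast
qed

end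

section \<open>Minors as sums over permutations\<close>

lemma permutes_agree_off:
  assumes "\<sigma> permutes S" "\<tau> permutes V - S" "S \<subseteq> V"
  shows "x \<in> S \<Longrightarrow> (\<sigma> \<circ> \<tau>) x = \<sigma> x" and "x \<notin> S \<Longrightarrow> (\<sigma> \<circ> \<tau>) x = \<tau> x"
proof -
  assume "x \<in> S"
  then have "\<tau> x = x" using assms(2) by (simp add: permutes_not_in)
  then show "(\<sigma> \<circ> \<tau>) x = \<sigma> x" by simp
next
  assume "x \<notin> S"
  then have "\<tau> x \<notin> S" 
    using assms(2,3) permutes_in_image[OF assms(2), of x] permutes_not_in[OF assms(2), of x] by auto
  then show "(\<sigma> \<circ> \<tau>) x = \<tau> x" using assms(1) by (simp add: permutes_not_in)
qed

definition restrict_perm :: "'a set \<Rightarrow> ('a \<Rightarrow> 'a) \<Rightarrow> 'a \<Rightarrow> 'a" where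
  "restrict_perm S p = (\<lambda>x. if x \<in> S then p x else x)"

lemma restrict_perm_permutes:
  assumes "inj p" "p ` S = S"
  shows "restrict_perm S p permutes S"
proof (rule bij_imp_permutes)
  show "bij_betw (restrict_perm S p) S S"
    using assms by (auto simp: bij_betw_def restrict_perm_def inj_on_def)
qed (auto simp: restrict_perm_def)

text \<open>The inverse map restricts a permutation stabilising \<open>S\<close> to \<open>S\<close>
  and to its complement.\<close>

lemma bij_betw_split_permutation:
  assumes "S \<subseteq> V"
  shows "bij_betw (\<lambda>(\<sigma>, \<tau>). \<sigma> \<circ> \<tau>) ({\<sigma>. \<sigma> permutes S} \<times> {\<tau>. \<tau> permutes V - S})
    {p. p permutes V \<and> p ` S = S}"
proof (rule bij_betw_byWitness[where f' = "\<lambda>p. (restrict_perm S p, restrict_perm (V - S) p)"])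
  show "\<forall>a\<in>{\<sigma>. \<sigma> permutes S} \<times> {\<tau>. \<tau> permutes V - S}.
      (\<lambda>p. (restrict_perm S p, restrict_perm (V - S) p)) ((\<lambda>(\<sigma>, \<tau>). \<sigma> \<circ> \<tau>) a) = a"
  proof (rule ballI)
    fix a assume "a \<in> {\<sigma>. \<sigma> permutes S} \<times> {\<tau>. \<tau> permutes V - S}"
    then obtain \<sigma> \<tau> where a: "a = (\<sigma>, \<tau>)" and p: "\<sigma> permutes S" "\<tau> permutes V - S" by blast
    have 1: "restrict_perm S (\<sigma> \<circ> \<tau>) = \<sigma>"
    proof
      fix x show "restrict_perm S (\<sigma> \<circ> \<tau>) x = \<sigma> x"
        using permutes_agree_off(1)[OF p assms, of x] permutes_not_in[OF p(1), of x]
        by (auto simp: restrict_perm_def)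
    qed
    have 2: "restrict_perm (V - S) (\<sigma> \<circ> \<tau>) = \<tau>"
    proof
      fix x show "restrict_perm (V - S) (\<sigma> \<circ> \<tau>) x = \<tau> x"
        using permutes_agree_off(2)[OF p assms, of x] permutes_not_in[OF p(2), of x]
        by (auto simp: restrict_perm_def)
    qed
    show "(\<lambda>p. (restrict_perm S p, restrict_perm (V - S) p)) ((\<lambda>(\<sigma>, \<tau>). \<sigma> \<circ> \<tau>) a) = a"
      using 1 2 a by simp
  qed
  show "\<forall>p\<in>{p. p permutes V \<and> p ` S = S}.
      (\<lambda>(\<sigma>, \<tau>). \<sigma> \<circ> \<tau>) (restrict_perm S p, restrict_perm (V - S) p) = p"
  proof (rule ballI)
    fix p assume "p \<in> {p. p permutes V \<and> p ` S = S}"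
    then have p: "p permutes V" "p ` S = S" by auto
    show "(\<lambda>(\<sigma>, \<tau>). \<sigma> \<circ> \<tau>) (restrict_perm S p, restrict_perm (V - S) p) = p"
    proof (rule ext)
      fix x
      consider "x \<in> S" | "x \<in> V - S" | "x \<notin> V" using assms by blast
      then show "(\<lambda>(\<sigma>, \<tau>). \<sigma> \<circ> \<tau>) (restrict_perm S p, restrict_perm (V - S) p) x = p x"
      proof cases
        case 2
        then have "p x \<notin> S" using p permutes_inj[OF p(1)] by (metis Diff_iff inj_image_mem_iff)
        then show ?thesis using 2 by (simp add: restrict_perm_def)
      qed (use p assms in \<open>auto simp: restrict_perm_def permutes_not_in\<close>)
    qed
  qed
  show "(\<lambda>(\<sigma>, \<tau>). \<sigma> \<circ> \<tau>) ` ({\<sigma>. \<sigma> permutes S} \<times> {\<tau>. \<tau> permutes V - S}) \<subseteq> {p. p permutes V \<and> p ` S = S}"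
  proof safe
    fix \<sigma> \<tau> assume p: "\<sigma> permutes S" "\<tau> permutes V - S"
    show "\<sigma> \<circ> \<tau> permutes V"
      using p assms permutes_subset[of \<sigma> S V] permutes_subset[of \<tau> "V - S" V] permutes_compose by blast
    have "(\<sigma> \<circ> \<tau>) ` S = \<sigma> ` S"
      using permutes_agree_off(1)[OF p assms] by (intro image_cong) auto
    then have im: "(\<sigma> \<circ> \<tau>) ` S = S" using permutes_image[OF p(1)] by simp
    show "x \<in> S \<Longrightarrow> (\<sigma> \<circ> \<tau>) x \<in> S" "x \<in> S \<Longrightarrow> x \<in> (\<sigma> \<circ> \<tau>) ` S" for x
      using im by blast+
  qed
  show "(\<lambda>p. (restrict_perm S p, restrict_perm (V - S) p)) ` {p. p permutes V \<and> p ` S = S}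
      \<subseteq> {\<sigma>. \<sigma> permutes S} \<times> {\<tau>. \<tau> permutes V - S}"
  proof safe
    fix p assume p: "p permutes V" "p ` S = S"
    have inj: "inj p" using permutes_inj p by blast
    show "restrict_perm S p permutes S" using inj p by (intro restrict_perm_permutes)
    have "p ` (V - S) = V - S"
      using p inj permutes_image[OF p(1)] by (simp add: image_set_diff)
    then show "restrict_perm (V - S) p permutes V - S" using inj by (intro restrict_perm_permutes)
  qed
qed

definition lap :: "nat set set \<Rightarrow> nat \<Rightarrow> nat \<Rightarrow> ipoly" where
  "lap E i j = (if i = j then Var i else if adj E i j then -1 else 0)"

text \<open>The Leibniz expansion of the determinant of the Laplacian restricted to rows and columns
  in \<open>S\<close>, written over the original vertex labels so that no renumbering of a submatrix
  is needed. It is 1 for empty \<open>S\<close>.\<close>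

definition principal_minor :: "nat set set \<Rightarrow> nat set \<Rightarrow> ipoly" where
  "principal_minor E S = (\<Sum>\<sigma> | \<sigma> permutes S. signof \<sigma> * (\<Prod>i\<in>S. lap E i (\<sigma> i)))"

text \<open>For permutations stabilising \<open>S\<close>, both the sign and the product of entries
  factor. \<open>R\<close> holds the omitted rows, and \<open>Q\<close> may restrict only the
  behaviour outside \<open>S\<close>, so the sum over the part on \<open>S\<close> is unrestricted
  and equals the principal minor.\<close>

lemma sum_split_permutations:
  assumes "finite V" "S \<subseteq> V" "R \<subseteq> V" "S \<inter> R = {}"
    and Q: "\<And>p q. (\<And>x. x \<notin> S \<Longrightarrow> p x = q x) \<Longrightarrow> Q p \<longleftrightarrow> Q q"
  shows "(\<Sum>p | p permutes V \<and> p ` S = S \<and> Q p. signof p * (\<Prod>i\<in>V - R. lap E i (p i))) =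
    principal_minor E S * (\<Sum>\<tau> | \<tau> permutes V - S \<and> Q \<tau>. signof \<tau> * (\<Prod>i\<in>V - S - R. lap E i (\<tau> i)))"
proof -
  let ?f = "\<lambda>(\<sigma>, \<tau>). \<sigma> \<circ> \<tau>" and ?P = "{\<sigma>. \<sigma> permutes S}" and ?T = "{\<tau>. \<tau> permutes V - S}"
  have fin: "finite S" "finite (V - S)" using assms finite_subset by auto
  have Qcomp: "Q (\<sigma> \<circ> \<tau>) \<longleftrightarrow> Q \<tau>" if "\<sigma> permutes S" "\<tau> permutes V - S" for \<sigma> \<tau>
    using permutes_agree_off(2)[OF that assms(2)] by (intro Q)
  have term_eq: "signof (\<sigma> \<circ> \<tau>) * (\<Prod>i\<in>V - R. lap E i ((\<sigma> \<circ> \<tau>) i)) =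
      signof \<sigma> * (\<Prod>i\<in>S. lap E i (\<sigma> i)) * (signof \<tau> * (\<Prod>i\<in>V - S - R. lap E i (\<tau> i)))"
    if "\<sigma> permutes S" "\<tau> permutes V - S" for \<sigma> \<tau>
  proof -
    have "permutation \<sigma>" "permutation \<tau>" using that fin permutes_imp_permutation by auto
    then have "signof (\<sigma> \<circ> \<tau>) = (signof \<sigma> * signof \<tau> :: ipoly)" by (simp add: sign_compose)
    moreover have "V - R = S \<union> (V - S - R)" using assms by blast
    then have "(\<Prod>i\<in>V - R. lap E i ((\<sigma> \<circ> \<tau>) i)) =
      (\<Prod>i\<in>S. lap E i ((\<sigma> \<circ> \<tau>) i)) * (\<Prod>i\<in>V - S - R. lap E i ((\<sigma> \<circ> \<tau>) i))"
      using fin by (metis (no_types, lifting) Diff_disjoint finite_Diff inf.orderE inf_assoc inf_bot_right 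
        Diff_subset prod.union_disjoint Int_Diff)
    moreover have "(\<Prod>i\<in>S. lap E i ((\<sigma> \<circ> \<tau>) i)) = (\<Prod>i\<in>S. lap E i (\<sigma> i))"
      using permutes_agree_off(1)[OF that assms(2)] by (intro prod.cong) auto
    moreover have "(\<Prod>i\<in>V - S - R. lap E i ((\<sigma> \<circ> \<tau>) i)) = (\<Prod>i\<in>V - S - R. lap E i (\<tau> i))"
      using permutes_agree_off(2)[OF that assms(2)] by (intro prod.cong) auto
    ultimately show ?thesis by (simp add: mult_ac)
  qed
  let ?g = "\<lambda>\<sigma>. signof \<sigma> * (\<Prod>i\<in>S. lap E i (\<sigma> i))"
    and ?h = "\<lambda>\<tau>. signof \<tau> * (\<Prod>i\<in>V - S - R. lap E i (\<tau> i)) :: ipoly"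
    and ?k = "\<lambda>p. signof p * (\<Prod>i\<in>V - R. lap E i (p i)) :: ipoly"
  have finp: "finite {p. p permutes V \<and> p ` S = S}"
    using finite_permutations[OF assms(1)] by (rule rev_finite_subset) auto
  have "(\<Sum>p | p permutes V \<and> p ` S = S \<and> Q p. ?k p) =
     (\<Sum>p\<in>{p\<in>{p. p permutes V \<and> p ` S = S}. Q p}. ?k p)"
    by (rule sum.cong) auto
  also have "\<dots> = (\<Sum>p\<in>{p. p permutes V \<and> p ` S = S}. if Q p then ?k p else 0)"
    by (rule sum.inter_filter[OF finp])
  also have "\<dots> = (\<Sum>x\<in>?P \<times> ?T. if Q (?f x) then ?k (?f x) else 0)"
    by (rule sum.reindex_bij_betw[OF bij_betw_split_permutation[OF assms(2)], symmetric])
  also have "\<dots> = (\<Sum>(\<sigma>, \<tau>)\<in>?P \<times> ?T. ?g \<sigma> * (if Q \<tau> then ?h \<tau> else 0))"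
  proof (rule sum.cong[OF refl])
    fix x assume "x \<in> ?P \<times> ?T"
    then obtain \<sigma> \<tau> where x: "x = (\<sigma>, \<tau>)" and st: "\<sigma> permutes S" "\<tau> permutes V - S" by blast
    show "(if Q (?f x) then ?k (?f x) else 0) =
        (case x of (\<sigma>, \<tau>) \<Rightarrow> ?g \<sigma> * (if Q \<tau> then ?h \<tau> else 0))"
      unfolding x prod.case using term_eq[OF st] Qcomp[OF st] by (simp only: mult_zero_right split: if_split) blast
  qed
  also have "\<dots> = principal_minor E S * (\<Sum>\<tau>\<in>?T. if Q \<tau> then ?h \<tau> else 0)"
    unfolding principal_minor_def sum_product sum.cartesian_product ..
  also have "(\<Sum>\<tau>\<in>?T. if Q \<tau> then ?h \<tau> else 0) = (\<Sum>\<tau>\<in>{\<tau>\<in>?T. Q \<tau>}. ?h \<tau>)"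
    by (rule sum.inter_filter[symmetric]) (rule finite_permutations[OF fin(2)])
  also have "\<dots> = (\<Sum>\<tau> | \<tau> permutes V - S \<and> Q \<tau>. ?h \<tau>)"
    by (rule sum.cong) auto
  finally show ?thesis .
qed

section \<open>Cofactors as sums over permutations\<close>

context finite_tree
begin

text \<open>The signed cofactor at row \<open>s\<close> and column \<open>t\<close>: the Leibniz
  terms with \<open>p s = t\<close>, with the entry in row \<open>s\<close> left out.\<close>

definition cof :: "nat \<Rightarrow> nat \<Rightarrow> ipoly" where
  "cof s t = (\<Sum>p | p permutes {0..<n} \<and> p s = t. signof p * (\<Prod>i\<in>{0..<n} - {s}. lap E i (p i)))"

text \<open>Indices from \<open>s\<close> on are shifted by one, which is the convention of
  \<open>mat_delete\<close>.\<close>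

lemma pick_delete:
  assumes "s < n" "i < n - 1"
  shows "pick ({0..<n} - {s}) i = (if i < s then i else Suc i)"
proof -
  let ?k = "if i < s then i else Suc i"
  have "{a \<in> {0..<n} - {s}. a < ?k} = (if i < s then {0..<i} else {0..<Suc i} - {s})"
    using assms by auto
  then have card: "card {a \<in> {0..<n} - {s}. a < ?k} = i"
    by (simp add: card_Diff_subset split: if_splits)
  have "?k \<in> {0..<n} - {s}" using assms by auto
  then have "pick ({0..<n} - {s}) (card {a \<in> {0..<n} - {s}. a < ?k}) = ?k"
    by (rule pick_card_in_set)
  then show ?thesis unfolding card .
qed

lemma submatrix_eq_mat_delete:
  assumes A: "A \<in> carrier_mat n n" and "s < n" "t < n"
  shows "submatrix A ({0..<n} - {s}) ({0..<n} - {t}) = mat_delete A s t"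
proof -
  have card: "card {i. i < n \<and> i \<in> {0..<n} - {v}} = n - 1" if "v < n" for v
  proof -
    have "{i. i < n \<and> i \<in> {0..<n} - {v}} = {0..<n} - {v}" by auto
    then show ?thesis using that by simp
  qed
  then show ?thesis using assms
    by (intro eq_matI) (auto simp: submatrix_def mat_delete_def pick_delete)
qed

text \<open>The determinant of the Laplacian with row \<open>s\<close> replaced by the unit vector
  at \<open>t\<close> is computed twice: by expansion along row \<open>s\<close> and by the Leibniz
  formula.\<close>

lemma minor_eq_cof:
  assumes "s < n" "t < n"
  shows "minor n E ({0..<n} - {s}) ({0..<n} - {t}) = (-1) ^ (s + t) * cof s t"
proof -
  let ?L = "gen_laplacian n E"
  define A where "A = mat n n (\<lambda>(i, j). if i = s then (if j = t then 1 else 0) else ?L $$ (i, j))"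
  have A: "A \<in> carrier_mat n n" and L: "?L \<in> carrier_mat n n"
    by (simp_all add: A_def gen_laplacian_def)
  have del: "mat_delete A s t = mat_delete ?L s t"
    using assms by (intro eq_matI) (auto simp: mat_delete_def A_def gen_laplacian_def)
  have "det A = (\<Sum>j<n. A $$ (s, j) * cofactor A s j)"
    using laplace_expansion_row[OF A assms(1)] .
  also have "\<dots> = (\<Sum>j<n. if j = t then cofactor A s t else 0)"
    using assms by (intro sum.cong) (auto simp: A_def)
  also have "\<dots> = (-1) ^ (s + t) * det (mat_delete ?L s t)"
    using assms by (simp add: cofactor_def del)
  finally have det1: "det A = (-1) ^ (s + t) * det (mat_delete ?L s t)" .
  have "det A = (\<Sum>p | p permutes {0..<n}. signof p * (\<Prod>i\<in>{0..<n}. A $$ (i, p i)))"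
    using det_def'[OF A] .
  also have "\<dots> = (\<Sum>p | p permutes {0..<n}. if p s = t then signof p * (\<Prod>i\<in>{0..<n} - {s}. lap E i (p i)) else 0)"
  proof (rule sum.cong)
    fix p assume "p \<in> {p. p permutes {0..<n}}"
    then have p: "p i < n" if "i < n" for i using permutes_in_image[of p "{0..<n}" i] that by auto
    have "(\<Prod>i\<in>{0..<n}. A $$ (i, p i)) = A $$ (s, p s) * (\<Prod>i\<in>{0..<n} - {s}. A $$ (i, p i))"
      using assms by (intro prod.remove) auto
    also have "(\<Prod>i\<in>{0..<n} - {s}. A $$ (i, p i)) = (\<Prod>i\<in>{0..<n} - {s}. lap E i (p i))"
      using p by (intro prod.cong) (auto simp: A_def gen_laplacian_def lap_def)
    also have "A $$ (s, p s) = (if p s = t then 1 else 0)" using p assms by (simp add: A_def)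
    finally show "signof p * (\<Prod>i\<in>{0..<n}. A $$ (i, p i)) =
      (if p s = t then signof p * (\<Prod>i\<in>{0..<n} - {s}. lap E i (p i)) else 0)" by simp
  qed simp
  also have "\<dots> = cof s t"
    unfolding cof_def using finite_permutations[of "{0..<n}"]
    by (simp add: sum.inter_filter[symmetric])
  finally have "cof s t = (-1) ^ (s + t) * det (mat_delete ?L s t)" using det1 by simp
  then have "(-1) ^ (s + t) * cof s t = ((-1) ^ (s + t) * (-1) ^ (s + t)) * det (mat_delete ?L s t)"
    by (simp add: mult.assoc)
  also have "(-1 :: ipoly) ^ (s + t) * (-1) ^ (s + t) = 1"
    by (simp flip: power_mult_distrib)
  finally show ?thesis by (simp add: minor_def submatrix_eq_mat_delete[OF L assms])
qed

end

section \<open>Principal minors\<close>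

definition sqfree :: "nat set \<Rightarrow> monom" where
  "sqfree S = (\<Sum>i\<in>S. single i 1)"

lemma lookup_sqfree: "finite S \<Longrightarrow> lookup (sqfree S) i = (if i \<in> S then 1 else 0)"
  by (simp add: sqfree_def lookup_sum lookup_single when_def)

lemma keys_sqfree: "finite S \<Longrightarrow> keys (sqfree S) = S"
  by (auto simp: in_keys_iff lookup_sqfree split: if_splits)

lemma mdeg_sqfree: "finite S \<Longrightarrow> mdeg (sqfree S) = card S"
  unfolding mdeg_def by (simp add: keys_sqfree lookup_sqfree)

lemma mdvd_sqfree: "finite S \<Longrightarrow> mdvd (sqfree S) m \<longleftrightarrow> S \<subseteq> keys m"
  by (auto simp: mdvd_def lookup_sqfree in_keys_iff Suc_le_eq)

text \<open>Only fixed points contribute a variable; every other factor is the constant -1 or 0, so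
  \<open>c\<close> may be zero.\<close>

lemma prod_lap_single:
  assumes "finite S"
  shows "\<exists>c. (\<Prod>i\<in>S. lap E i (\<sigma> i)) = single (sqfree {i\<in>S. \<sigma> i = i}) c"
  using assms
proof (induction S rule: finite_induct)
  case empty
  show ?case by (intro exI[of _ 1]) (simp add: sqfree_def)
next
  case (insert x F)
  then obtain c where c: "(\<Prod>i\<in>F. lap E i (\<sigma> i)) = single (sqfree {i\<in>F. \<sigma> i = i}) c" by blast
  show ?case
  proof (cases "\<sigma> x = x")
    case True
    then have "{i\<in>insert x F. \<sigma> i = i} = insert x {i\<in>F. \<sigma> i = i}" by auto
    then have "sqfree {i\<in>insert x F. \<sigma> i = i} = single x 1 + sqfree {i\<in>F. \<sigma> i = i}"
      using insert.hyps by (simp add: sqfree_def)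
    then show ?thesis using insert.hyps True c
      by (auto simp: lap_def Var_def mult_single)
  next
    case False
    then have *: "{i\<in>insert x F. \<sigma> i = i} = {i\<in>F. \<sigma> i = i}" by auto
    have lap: "lap E x (\<sigma> x) = single 0 (if adj E x (\<sigma> x) then -1 else 0)"
      using False by (auto simp: lap_def single_uminus)
    have "(\<Prod>i\<in>insert x F. lap E i (\<sigma> i)) =
        single (sqfree {i\<in>F. \<sigma> i = i}) ((if adj E x (\<sigma> x) then -1 else 0) * c)"
      by (simp only: prod.insert[OF insert.hyps] c lap mult_single add_0_left)
    then show ?thesis unfolding * by blast
  qed
qed

lemma prod_lap_diagonal: "finite S \<Longrightarrow> (\<Prod>i\<in>S. lap E i i) = single (sqfree S) 1"
proof (induction S rule: finite_induct)
  case (insert x F)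
  then show ?case by (simp add: lap_def Var_def mult_single sqfree_def)
qed (simp add: sqfree_def)

text \<open>The identity contributes the product of all variables in \<open>S\<close>. Any other
  permutation moves a vertex of \<open>S\<close>, whose variable is then missing from its
  term.\<close>

lemma keys_principal_minor_tail:
  assumes S: "finite S" and m: "m \<in> keys (principal_minor E S - single (sqfree S) 1)"
  shows "\<exists>T. T \<subset> S \<and> m = sqfree T"
proof -
  let ?P = "{\<sigma>. \<sigma> permutes S}"
  have "principal_minor E S = signof id * (\<Prod>i\<in>S. lap E i (id i))
      + (\<Sum>\<sigma>\<in>?P - {id}. signof \<sigma> * (\<Prod>i\<in>S. lap E i (\<sigma> i)))"
    unfolding principal_minor_def using finite_permutations[OF S] permutes_id
    by (intro sum.remove) auto
  then have "principal_minor E S - single (sqfree S) 1 = (\<Sum>\<sigma>\<in>?P - {id}. signof \<sigma> * (\<Prod>i\<in>S. lap E i (\<sigma> i)))"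
    using prod_lap_diagonal[OF S] by simp
  then obtain \<sigma> where \<sigma>: "\<sigma> permutes S" "\<sigma> \<noteq> id" "m \<in> keys (signof \<sigma> * (\<Prod>i\<in>S. lap E i (\<sigma> i)))"
    using m keys_sum[of "\<lambda>\<sigma>. signof \<sigma> * (\<Prod>i\<in>S. lap E i (\<sigma> i))" "?P - {id}"] by auto
  obtain c where c: "(\<Prod>i\<in>S. lap E i (\<sigma> i)) = single (sqfree {i\<in>S. \<sigma> i = i}) c"
    using prod_lap_single[OF S] by blast
  have "signof \<sigma> * (\<Prod>i\<in>S. lap E i (\<sigma> i)) = single (sqfree {i\<in>S. \<sigma> i = i}) (sign \<sigma> * c)"
    unfolding c by (cases \<sigma> rule: sign_cases) (simp_all add: single_uminus)
  then have "m = sqfree {i\<in>S. \<sigma> i = i}" using \<sigma>(3) by (simp split: if_splits)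
  moreover have "{i\<in>S. \<sigma> i = i} \<noteq> S"
  proof
    assume eq: "{i\<in>S. \<sigma> i = i} = S"
    have "\<sigma> i = i" for i using eq permutes_not_in[OF \<sigma>(1), of i] by (cases "i \<in> S") blast+
    then show False using \<sigma>(2) by auto
  qed
  then have "{i\<in>S. \<sigma> i = i} \<subset> S" by (intro psubsetI) auto
  ultimately show ?thesis by (intro exI[of _ "{i\<in>S. \<sigma> i = i}"] conjI)
qed

lemma mdeg_principal_minor_tail:
  assumes "finite S" "m \<in> keys (principal_minor E S - single (sqfree S) 1)"
  shows "mdeg m < mdeg (sqfree S)"
proof -
  obtain T where "T \<subset> S" "m = sqfree T" using keys_principal_minor_tail[OF assms] by blast
  moreover then have "finite T" using assms(1) finite_subset by blast
  ultimately show ?thesis using assms(1) by (simp add: mdeg_sqfree psubset_card_mono)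
qed

lemma lookup_principal_minor_top:
  assumes "finite S"
  shows "lookup (principal_minor E S) (sqfree S) = 1"
proof -
  have "sqfree S \<notin> keys (principal_minor E S - single (sqfree S) 1)"
    using mdeg_principal_minor_tail[OF assms] by blast
  then show ?thesis by (simp add: in_keys_iff lookup_minus)
qed

lemma keys_principal_minor:
  assumes "m \<in> keys (principal_minor E S)"
  shows "m = sqfree S \<or> m \<in> keys (principal_minor E S - single (sqfree S) 1)"
  using assms by (auto simp: in_keys_iff lookup_minus lookup_single when_def)

lemma keys_principal_minor_subset:
  assumes S: "finite S" and m: "m \<in> keys (principal_minor E S)"
  shows "keys m \<subseteq> S"
  using keys_principal_minor[OF m]
proof
  assume "m \<in> keys (principal_minor E S - single (sqfree S) 1)"
  then obtain T where "T \<subset> S" "m = sqfree T" using keys_principal_minor_tail[OF S] by blast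
  moreover then have "finite T" using S finite_subset by blast
  ultimately show ?thesis by (auto simp: keys_sqfree)
qed (simp add: keys_sqfree S)

lemma lp_principal_minor: "finite S \<Longrightarrow> lp (principal_minor E S) = sqfree S"
proof (rule lp_eqI)
  assume S: "finite S"
  show "sqfree S \<in> keys (principal_minor E S)" using lookup_principal_minor_top[OF S] by (simp add: in_keys_iff)
  fix m assume "m \<in> keys (principal_minor E S)" "m \<noteq> sqfree S"
  then show "deglex_less m (sqfree S)"
    using keys_principal_minor mdeg_principal_minor_tail[OF S] unfolding deglex_less_def by blast
qed

lemma lc_principal_minor: "finite S \<Longrightarrow> lc (principal_minor E S) = 1"
  by (simp add: lc_def lp_principal_minor lookup_principal_minor_top)

lemma normalize_sign_principal_minor:
  assumes "finite S" "c = 1 \<or> c = -1"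
  shows "normalize_sign (c * principal_minor E S) = principal_minor E S"
proof -
  have "lp (- p) = lp p" for p by (simp add: lp_def)
  then have "lc (- principal_minor E S) = -1" using lc_principal_minor[OF assms(1)] by (simp add: lc_def)
  then show ?thesis using assms by (auto simp: normalize_sign_def lc_principal_minor)
qed

section \<open>Cofactors of the Laplacian of a tree\<close>

lemma cycle_of_list_nth:
  assumes "distinct xs" "i < length xs"
  shows "cycle_of_list xs (xs ! i) = xs ! (Suc i mod length xs)"
proof -
  have "map (cycle_of_list xs) xs = rotate1 xs" using cyclic_rotation[OF assms(1), of 1] by simp
  then show ?thesis using assms(2) nth_rotate1 by (metis nth_map)
qed

context finite_tree
begin

text \<open>The iterates of \<open>p\<close> from \<open>t\<close> walk along edges until they reach
  \<open>s\<close>. Up to that moment they are distinct, so they form the unique path from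
  \<open>t\<close> to \<open>s\<close>, and \<open>p s = t\<close> closes it to a cycle.\<close>

lemma permutation_along_path:
  assumes p: "p permutes {0..<n}" "p s = t"
    and step: "\<And>i. i \<in> {0..<n} - {s} \<Longrightarrow> p i = i \<or> adj E i (p i)"
    and xs: "is_path xs" "hd xs = t" "last xs = s"
    and x: "x \<in> set xs"
  shows "p x = cycle_of_list xs x"
proof -
  have inj: "inj p" using permutes_inj p(1) by blast
  have "t < n" using xs path_ends by blast
  then have lt: "(p ^^ i) t < n" for i
    by (induction i) (use permutes_in_image[OF p(1)] in auto)
  obtain N where N: "p ^^ N = id" "N > 0"
    using permutation_is_nilpotent[OF permutes_imp_permutation[OF _ p(1)]] by auto
  then obtain N' where "N = Suc N'" by (cases N) auto
  \<comment> \<open>Since \<open>p\<close> has finite order, the predecessor \<open>s\<close> of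
    \<open>t\<close> is itself an iterate of \<open>t\<close>.\<close>
  then have "p ((p ^^ N') t) = p s" using N(1) p(2) by (metis comp_apply funpow.simps(2) id_apply)
  then have ex: "\<exists>k. (p ^^ k) t = s" using inj by (auto dest: injD)
  define k where "k = (LEAST k. (p ^^ k) t = s)"
  have k: "(p ^^ k) t = s" unfolding k_def using ex by (rule LeastI_ex)
  have least: "(p ^^ i) t \<noteq> s" if "i < k" for i using not_less_Least that unfolding k_def by blast
  have diff: "(p ^^ i) t \<noteq> (p ^^ j) t" if "i < j" "j \<le> k" for i j
  proof
    assume "(p ^^ i) t = (p ^^ j) t"
    \<comment> \<open>A repetition, pushed forward by \<open>k - j\<close> steps, would make the
      orbit reach \<open>s\<close> before time \<open>k\<close>.\<close>
    then have "(p ^^ (k - j)) ((p ^^ i) t) = (p ^^ (k - j)) ((p ^^ j) t)" by simp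
    then have "(p ^^ (k - j + i)) t = (p ^^ (k - j + j)) t" by (simp add: funpow_add)
    then have "(p ^^ (k - j + i)) t = s" using that k by simp
    moreover have "k - j + i < k" using that by linarith
    ultimately show False using least by blast
  qed
  define ws where "ws = map (\<lambda>i. (p ^^ i) t) [0..<Suc k]"
  have len: "length ws = Suc k" and nth: "ws ! i = (p ^^ i) t" if "i \<le> k" for i
    using that by (simp_all add: ws_def del: upt_Suc)
  have "distinct ws"
    unfolding distinct_conv_nth using diff nth len[of 0]
    by (auto simp: less_Suc_eq_le) (metis linorder_neqE_nat)
  moreover have "successively (adj E) ws"
    unfolding successively_conv_nth
  proof (intro allI impI)
    fix i assume "Suc i < length ws"
    then have i: "i < k" using len[of 0] by simp
    then have "p ((p ^^ i) t) = (p ^^ i) t \<or> adj E ((p ^^ i) t) (p ((p ^^ i) t))"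
      using step[of "(p ^^ i) t"] least lt by auto
    then show "adj E (ws ! i) (ws ! Suc i)" using diff[of i "Suc i"] i nth by auto
  qed
  moreover have "set ws \<subseteq> {0..<n}" using lt by (auto simp: ws_def)
  ultimately have "is_path ws" using len[of 0] by (auto simp: is_path_def)
  moreover have "hd ws = t" "last ws = s"
    using k by (simp_all add: ws_def hd_map last_map del: upt_Suc)
  ultimately have "ws = xs" using path_unique xs by blast
  then obtain i where i: "i \<le> k" "x = ws ! i"
    using x len[of 0] by (metis in_set_conv_nth less_Suc_eq_le le0)
  have "cycle_of_list ws (ws ! i) = ws ! (Suc i mod Suc k)"
    using cycle_of_list_nth[OF \<open>distinct ws\<close>, of i] i len[of 0] by simp
  also have "\<dots> = p (ws ! i)"
  proof (cases "i = k")
    case True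
    then show ?thesis using nth[of 0] nth[of k] k p(2) by simp
  next
    case False
    then show ?thesis using i nth[of "Suc i"] nth[of i] by simp
  qed
  finally show ?thesis using i \<open>ws = xs\<close> by simp
qed

lemma prod_lap_nonzero_step:
  assumes "(\<Prod>i\<in>A. lap E i (p i)) \<noteq> 0" "finite A" "i \<in> A"
  shows "p i = i \<or> adj E i (p i)"
  using assms by (metis lap_def prod_zero)

text \<open>A nonzero term comes from a permutation that acts on the path as the cycle
  \<open>cycle_of_list xs\<close>. It therefore preserves the complement, and the cofactor is the
  principal minor there times the single term of the cycle.\<close>

lemma cof_path:
  assumes xs: "is_path xs"
  shows "\<exists>c. (c = 1 \<or> c = -1) \<and> cof (last xs) (hd xs) = c * principal_minor E ({0..<n} - set xs)"
proof -
  let ?V = "{0..<n}" and ?s = "last xs" and ?t = "hd xs" and ?c = "cycle_of_list xs"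
  let ?S = "?V - set xs"
  let ?term = "\<lambda>A p. signof p * (\<Prod>i\<in>A - {?s}. lap E i (p i)) :: ipoly"
  have ne: "xs \<noteq> []" and dist: "distinct xs" and sub: "set xs \<subseteq> ?V" and adj: "successively (adj E) xs"
    using xs by (auto simp: is_path_def)
  have VS: "?V - ?S = set xs" using sub by blast
  have s: "?s \<in> set xs" using ne by simp
  have cperm: "?c permutes set xs" by (rule cycle_permutes)
  have finP: "finite {p. p permutes ?V}" "finite {p. p permutes set xs}"
    by (simp_all add: finite_permutations)
  have agree: "p x = ?c x" if "p permutes ?V" "p ?s = ?t" "?term ?V p \<noteq> 0" "x \<in> set xs" for p x
    using that prod_lap_nonzero_step[of p "?V - {?s}"]
    by (intro permutation_along_path[OF that(1,2) _ xs refl refl]) auto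
  have "cof ?s ?t = (\<Sum>p | p permutes ?V \<and> p ` ?S = ?S \<and> p ?s = ?t. ?term ?V p)"
    unfolding cof_def
  proof (rule sum.mono_neutral_right)
    show "\<forall>p\<in>{p. p permutes ?V \<and> p ?s = ?t} - {p. p permutes ?V \<and> p ` ?S = ?S \<and> p ?s = ?t}. ?term ?V p = 0"
    proof (rule ballI, rule ccontr)
      fix p assume p: "p \<in> {p. p permutes ?V \<and> p ?s = ?t} - {p. p permutes ?V \<and> p ` ?S = ?S \<and> p ?s = ?t}"
        and nz: "?term ?V p \<noteq> 0"
      have "p ` set xs = ?c ` set xs" using p nz agree by (intro image_cong) auto
      then have "p ` set xs = set xs" using permutes_image[OF cperm] by simp
      then have "p ` ?S = ?S" using p permutes_inj[of p ?V] permutes_image[of p ?V]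
        by (simp add: image_set_diff)
      then show False using p by blast
    qed
  qed (use finP in \<open>auto intro: rev_finite_subset\<close>)
  also have "\<dots> = principal_minor E ?S * (\<Sum>\<tau> | \<tau> permutes ?V - ?S \<and> \<tau> ?s = ?t. ?term (?V - ?S) \<tau>)"
    by (rule sum_split_permutations) (use s sub in auto)
  \<comment> \<open>The factor on the path has at most one nonzero term, again by
    \<open>permutation_along_path\<close>.\<close>
  also have "(\<Sum>\<tau> | \<tau> permutes ?V - ?S \<and> \<tau> ?s = ?t. ?term (?V - ?S) \<tau>) = (\<Sum>\<tau>\<in>{?c}. ?term (set xs) \<tau>)"
    unfolding VS
  proof (rule sum.mono_neutral_right)
    have "?c (xs ! (length xs - 1)) = xs ! 0"
      using ne by (subst cycle_of_list_nth[OF dist]) auto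
    then have "?c ?s = ?t" using ne by (simp add: hd_conv_nth last_conv_nth)
    then show "{?c} \<subseteq> {\<tau>. \<tau> permutes set xs \<and> \<tau> ?s = ?t}" using cperm by simp
    show "\<forall>\<tau>\<in>{\<tau>. \<tau> permutes set xs \<and> \<tau> ?s = ?t} - {?c}. ?term (set xs) \<tau> = 0"
    proof (rule ballI, rule ccontr)
      fix \<tau> assume t: "\<tau> \<in> {\<tau>. \<tau> permutes set xs \<and> \<tau> ?s = ?t} - {?c}"
        and nz: "?term (set xs) \<tau> \<noteq> 0"
      have perm: "\<tau> permutes set xs" using t by blast
      have "\<tau> x = ?c x" for x
      proof (cases "x \<in> set xs")
        case True
        have step: "\<tau> i = i \<or> adj E i (\<tau> i)" if "i \<in> ?V - {?s}" for i
          using prod_lap_nonzero_step[of \<tau> "set xs - {?s}" i] nz that permutes_not_in[OF perm, of i]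
          by (cases "i \<in> set xs") auto
        show ?thesis
          by (rule permutation_along_path[OF permutes_subset[OF perm sub] _ step xs refl refl True])
            (use t in auto)
      qed (use perm cperm in \<open>simp add: permutes_not_in\<close>)
      then show False using t by auto
    qed
  qed (use finP in \<open>auto intro: rev_finite_subset\<close>)
  \<comment> \<open>The cycle moves each vertex except the last along an edge, and the row of the
    last vertex is omitted, so every entry is -1.\<close>
  also have "\<dots> = signof ?c * (\<Prod>i\<in>set xs - {?s}. -1)"
  proof -
    have "lap E x (?c x) = -1" if "x \<in> set xs - {?s}" for x
    proof -
      have "x \<in> set xs" using that by blast
      then obtain i where i: "i < length xs" "x = xs ! i" unfolding in_set_conv_nth by blast
      have "i \<noteq> length xs - 1"
      proof
        assume "i = length xs - 1"
        then have "x = last xs" using i last_conv_nth[OF ne] by simp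
        then show False using that by simp
      qed
      then have "Suc i < length xs" using i by simp
      then have "?c x = xs ! Suc i" "adj E x (xs ! Suc i)"
        using i cycle_of_list_nth[OF dist, of i] adj by (auto simp: successively_conv_nth)
      then show ?thesis using adj_vertices[of x "xs ! Suc i"] by (simp add: lap_def)
    qed
    then show ?thesis by simp
  qed
  finally have "cof ?s ?t = (signof ?c * (-1) ^ card (set xs - {?s})) * principal_minor E ?S"
    by (simp add: mult.commute)
  moreover have "(signof ?c * (-1) ^ card (set xs - {?s}) :: ipoly) \<in> {1, -1}"
    by (cases ?c rule: sign_cases) (auto simp: minus_one_power_iff)
  ultimately show ?thesis by blast
qed

text \<open>The omitted row is \<open>hd xs\<close> here, so \<open>cof_path\<close> is applied to
  the reversed path.\<close>

lemma minor_path: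
  assumes xs: "is_path xs"
  shows "\<exists>c. (c = 1 \<or> c = -1) \<and>
    minor n E ({0..<n} - {hd xs}) ({0..<n} - {last xs}) = c * principal_minor E ({0..<n} - set xs)"
proof -
  have ne: "xs \<noteq> []" using xs by (simp add: is_path_def)
  have lt: "hd xs < n" "last xs < n" using path_ends[OF xs] .
  obtain c where c: "c = 1 \<or> c = -1" "cof (hd xs) (last xs) = c * principal_minor E ({0..<n} - set xs)"
    using cof_path[of "rev xs"] xs is_path_rev[of xs] ne by (auto simp: hd_rev last_rev)
  have "minor n E ({0..<n} - {hd xs}) ({0..<n} - {last xs}) =
      ((-1) ^ (hd xs + last xs) * c) * principal_minor E ({0..<n} - set xs)"
    using minor_eq_cof[OF lt] c(2) by (simp add: mult.assoc)
  moreover have "(-1 :: ipoly) ^ (hd xs + last xs) \<in> {1, -1}" by (auto simp: minus_one_power_iff)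
  then have "(-1) ^ (hd xs + last xs) * c = 1 \<or> (-1) ^ (hd xs + last xs) * c = -1" using c(1) by auto
  ultimately show ?thesis by blast
qed

section \<open>Cofactors lie in the ideal of three branches\<close>

text \<open>A permutation contributing to the cofactor moves along edges except at \<open>s\<close>, so it can leave a
  branch at \<open>m\<close> only through \<open>s\<close> or through the preimage of \<open>m\<close>.\<close>

lemma permutation_preserves_branch:
  fixes B :: "nat \<Rightarrow> nat set"
  assumes p: "p permutes {0..<n}" and nz: "(\<Prod>i\<in>{0..<n} - {s}. lap E i (p i)) \<noteq> 0"
    and sub: "\<And>j. j < 3 \<Longrightarrow> B j \<subseteq> {0..<n}"
    and closed: "\<And>i j k. j < 3 \<Longrightarrow> i \<in> B j \<Longrightarrow> adj E i k \<Longrightarrow> k \<noteq> m \<Longrightarrow> k \<in> B j"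
    and disj: "\<And>i j. i < 3 \<Longrightarrow> j < 3 \<Longrightarrow> i \<noteq> j \<Longrightarrow> B i \<inter> B j = {}"
  shows "\<exists>j<3. s \<notin> B j \<and> p ` B j = B j"
proof (rule ccontr)
  assume none: "\<not> ?thesis"
  define q where "q = inv_into UNIV p m"
  have *: "s \<in> B j \<or> q \<in> B j" if j: "j < (3 :: nat)" for j
  proof (cases "s \<in> B j")
    case False
    have fin: "finite (B j)" using sub[OF j] finite_subset by blast
    have "p ` B j \<noteq> B j" using none j False by blast
    then have "\<not> p ` B j \<subseteq> B j"
      using endo_inj_surj[OF fin _ inj_on_subset[OF permutes_inj[OF p]]] by blast
    then obtain i where i: "i \<in> B j" "p i \<notin> B j" by blast
    then have "i \<in> {0..<n} - {s}" using sub[OF j] False by blast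
    then have "adj E i (p i)" using prod_lap_nonzero_step[OF nz] i by force
    then have "p i = m" using closed[OF j i(1)] i(2) by blast
    then have "q = i" unfolding q_def using permutes_inverses(2)[OF p] by metis
    then show ?thesis using i by simp
  qed simp
  \<comment> \<open>Pigeonhole: the two vertices \<open>s\<close> and \<open>q\<close> cannot meet
    three pairwise disjoint sets.\<close>
  have "B 0 \<inter> B 1 = {}" "B 0 \<inter> B 2 = {}" "B 1 \<inter> B 2 = {}" by (rule disj; simp)+
  then show False using *[of 0] *[of 1] *[of 2] by auto
qed

text \<open>Each nonzero term is assigned to the first branch that avoids \<open>s\<close> and is
  preserved by the permutation. The terms assigned to branch \<open>j\<close> together are a
  multiple of its principal minor.\<close>

lemma cof_in_branch_ideal:
  fixes B :: "nat \<Rightarrow> nat set"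
  assumes s: "s < n"
    and sub: "\<And>j. j < 3 \<Longrightarrow> B j \<subseteq> {0..<n}"
    and closed: "\<And>i j k. j < 3 \<Longrightarrow> i \<in> B j \<Longrightarrow> adj E i k \<Longrightarrow> k \<noteq> m \<Longrightarrow> k \<in> B j"
    and disj: "\<And>i j. i < 3 \<Longrightarrow> j < 3 \<Longrightarrow> i \<noteq> j \<Longrightarrow> B i \<inter> B j = {}"
  shows "cof s t \<in> ideal_gen ((\<lambda>j. principal_minor E (B j)) ` {..<3})"
proof -
  let ?V = "{0..<n}"
  let ?I = "ideal_gen ((\<lambda>j. principal_minor E (B j)) ` {..<3})"
  let ?term = "\<lambda>p. signof p * (\<Prod>i\<in>?V - {s}. lap E i (p i)) :: ipoly"
  define good where "good j p \<longleftrightarrow> s \<notin> B j \<and> p ` B j = B j" for j p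
  define first where "first j p \<longleftrightarrow> good j p \<and> (\<forall>i<j. \<not> good i p)" for j p
  have term_split: "?term p = (\<Sum>j<3. if first j p then ?term p else 0)"
    if p: "p permutes ?V" for p
  proof (cases "?term p = 0")
    case False
    then have nz: "(\<Prod>i\<in>?V - {s}. lap E i (p i)) \<noteq> 0" by auto
    have "\<exists>j<3. s \<notin> B j \<and> p ` B j = B j"
      by (rule permutation_preserves_branch[OF p nz, where m = m])
        (rule sub closed disj; assumption)+
    then obtain j0 where j0: "j0 < 3" "good j0 p" unfolding good_def by blast
    define j where "j = (LEAST j. good j p)"
    have "good j p" unfolding j_def using j0(2) by (rule LeastI)
    moreover have "j \<le> j0" unfolding j_def using j0(2) by (rule Least_le)
    moreover have "\<not> good i p" if "i < j" for i using that not_less_Least unfolding j_def by blast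
    ultimately have "j < 3" "first i p \<longleftrightarrow> i = j" for i
      using j0(1) unfolding first_def by (force, metis linorder_neqE_nat)
    then show ?thesis by simp
  next
    case True
    show ?thesis unfolding True by simp
  qed
  have first_in: "(\<Sum>p | p permutes ?V \<and> p s = t \<and> first j p. ?term p) \<in> ?I" if j: "j < 3" for j
  proof (cases "s \<in> B j")
    case True
    then have "\<not> first j p" for p by (simp add: first_def good_def)
    then show ?thesis by (simp add: ideal_gen_zero)
  next
    case False
    define Q where "Q p \<longleftrightarrow> p s = t \<and> (\<forall>i<j. \<not> good i p)" for p
    \<comment> \<open>Because the branches are disjoint, failure of the earlier ones is decided
      outside \<open>B j\<close>, as \<open>sum_split_permutations\<close> demands.\<close>
    have Q_cong: "Q p \<longleftrightarrow> Q q" if "\<And>x. x \<notin> B j \<Longrightarrow> p x = q x" for p q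
    proof -
      have "p s = q s" using that False by blast
      moreover have "good i p \<longleftrightarrow> good i q" if i: "i < j" for i
      proof -
        have "B i \<inter> B j = {}" using i j by (intro disj) auto
        then have "p ` B i = q ` B i" using \<open>\<And>x. x \<notin> B j \<Longrightarrow> p x = q x\<close> by (intro image_cong) auto
        then show ?thesis by (simp add: good_def)
      qed
      ultimately show ?thesis by (auto simp: Q_def)
    qed
    have "(\<Sum>p | p permutes ?V \<and> p s = t \<and> first j p. ?term p) =
        (\<Sum>p | p permutes ?V \<and> p ` B j = B j \<and> Q p. ?term p)"
      using False by (intro sum.cong) (auto simp: first_def good_def Q_def)
    also have "\<dots> = principal_minor E (B j) *
        (\<Sum>\<tau> | \<tau> permutes ?V - B j \<and> Q \<tau>. signof \<tau> * (\<Prod>i\<in>?V - B j - {s}. lap E i (\<tau> i)))"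
      using s False sub[OF j] by (intro sum_split_permutations Q_cong) auto
    also have "\<dots> \<in> ?I"
      by (subst mult.commute, rule ideal_gen_mult, rule ideal_gen_base) (use j in blast)
    finally show ?thesis .
  qed
  have finV: "finite {p. p permutes ?V \<and> p s = t}"
    using finite_permutations[of ?V] by (rule rev_finite_subset) auto
  have "cof s t = (\<Sum>p | p permutes ?V \<and> p s = t. \<Sum>j<3. if first j p then ?term p else 0)"
    unfolding cof_def by (rule sum.cong[OF refl], rule term_split) simp
  also have "\<dots> = (\<Sum>j<3. \<Sum>p | p permutes ?V \<and> p s = t. if first j p then ?term p else 0)"
    by (rule sum.swap)
  also have "\<dots> = (\<Sum>j<3. \<Sum>p | p permutes ?V \<and> p s = t \<and> first j p. ?term p)"
  proof (rule sum.cong[OF refl])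
    fix j
    have "(\<Sum>p | p permutes ?V \<and> p s = t. if first j p then ?term p else 0) =
        (\<Sum>p\<in>{p\<in>{p. p permutes ?V \<and> p s = t}. first j p}. ?term p)"
      by (rule sum.inter_filter[OF finV, symmetric])
    also have "{p\<in>{p. p permutes ?V \<and> p s = t}. first j p} = {p. p permutes ?V \<and> p s = t \<and> first j p}"
      by auto
    finally show "(\<Sum>p | p permutes ?V \<and> p s = t. if first j p then ?term p else 0) =
        (\<Sum>p | p permutes ?V \<and> p s = t \<and> first j p. ?term p)" .
  qed
  also have "\<dots> \<in> ?I"
  proof -
    have "(\<Sum>j\<in>A. \<Sum>p | p permutes ?V \<and> p s = t \<and> first j p. ?term p) \<in> ?I"
      if "finite A" "A \<subseteq> {..<3}" for A :: "nat set"
      using that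
    proof (induction A rule: finite_induct)
      case (insert x F)
      then show ?case unfolding sum.insert[OF insert.hyps] by (intro ideal_gen_add first_in) auto
    qed (simp add: ideal_gen_zero)
    then show ?thesis by blast
  qed
  finally show ?thesis .
qed

section \<open>The Groebner basis\<close>

lemma subset_card_pred:
  assumes "R \<subseteq> {0..<n}" "card R = n - 1"
  shows "\<exists>s<n. R = {0..<n} - {s}"
proof -
  have "card ({0..<n} - R) = 1"
    using assms n_pos by (simp add: card_Diff_subset finite_subset)
  then obtain s where "{0..<n} - R = {s}" by (auto simp: card_1_singleton_iff)
  then show ?thesis using assms(1) by (intro exI[of _ s]) auto
qed

lemma minor_ideal_le_branch_ideal:
  fixes B :: "nat \<Rightarrow> nat set"
  assumes "\<And>j. j < 3 \<Longrightarrow> B j \<subseteq> {0..<n}"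
    and "\<And>i j k. j < 3 \<Longrightarrow> i \<in> B j \<Longrightarrow> adj E i k \<Longrightarrow> k \<noteq> m \<Longrightarrow> k \<in> B j"
    and "\<And>i j. i < 3 \<Longrightarrow> j < 3 \<Longrightarrow> i \<noteq> j \<Longrightarrow> B i \<inter> B j = {}"
  shows "minor_ideal n E (n - 1) \<subseteq> ideal_gen ((\<lambda>j. principal_minor E (B j)) ` {..<3})"
  unfolding minor_ideal_def
proof (rule ideal_gen_minimal, safe)
  fix R C :: "nat set" assume R: "R \<subseteq> {0..<n}" "card R = n - 1" and C: "C \<subseteq> {0..<n}" "card C = n - 1"
  obtain s where s: "s < n" "R = {0..<n} - {s}" using subset_card_pred[OF R] by blast
  obtain t where t: "t < n" "C = {0..<n} - {t}" using subset_card_pred[OF C] by blast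
  note st = s(1) t(1) s(2) t(2)
  show "minor n E R C \<in> ideal_gen ((\<lambda>j. principal_minor E (B j)) ` {..<3})"
    unfolding st(3,4) minor_eq_cof[OF st(1,2)]
    by (rule ideal_gen_mult, rule cof_in_branch_ideal[OF st(1) assms])
qed

text \<open>Otherwise three vertices absent from \<open>m\<close> lie in different branches, and
  \<open>top_key_dvd\<close> puts a whole branch, including its absent vertex, into
  \<open>keys m\<close>.\<close>

lemma top_key_covered_by_path:
  assumes f: "f \<in> minor_ideal n E (n - 1)"
    and m: "m \<in> keys f" "\<And>m'. m' \<in> keys f \<Longrightarrow> mdeg m' \<le> mdeg m"
  shows "\<exists>xs. is_path xs \<and> {0..<n} - set xs \<subseteq> keys m"
proof (rule ccontr)
  assume none: "\<not> ?thesis"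
  let ?Z = "{0..<n} - keys m"
  have "\<not> ?Z \<subseteq> set xs" if "is_path xs" for xs using none that by blast
  then obtain v a b c where abc: "a \<in> ?Z" "b \<in> ?Z" "c \<in> ?Z" "a \<noteq> v" "b \<noteq> v" "c \<noteq> v"
    and disj: "branch v a \<inter> branch v b = {}" "branch v c \<inter> branch v a = {}" "branch v c \<inter> branch v b = {}"
    using tripod_exists[of ?Z] by (metis Diff_subset)
  define x where "x j = (if j = 0 then a else if j = 1 then b else c)" for j :: nat
  define B where "B j = branch v (x j)" for j
  have x: "x j \<in> ?Z" "x j \<in> B j" for j
    using abc branch_self by (auto simp: x_def B_def)
  have sub: "B j \<subseteq> {0..<n}" and closed: "i \<in> B j \<Longrightarrow> adj E i k \<Longrightarrow> k \<noteq> v \<Longrightarrow> k \<in> B j" for i j k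
    using branch_subset branch_step by (auto simp: B_def)
  have disjB: "B i \<inter> B j = {}" if "i < 3" "j < 3" "i \<noteq> j" for i j
  proof -
    have "i \<in> {0, 1, 2}" "j \<in> {0, 1, 2}" using that by auto
    then show ?thesis using that(3) disj by (auto simp: B_def x_def)
  qed
  have fin: "finite (B j)" for j using sub finite_subset by blast
  have "f \<in> ideal_gen ((\<lambda>j. principal_minor E (B j)) ` {..<3})"
    using minor_ideal_le_branch_ideal[of B v] sub closed disjB f by blast
  then obtain h where h: "f = (\<Sum>j<3. h j * principal_minor E (B j))"
    using ideal_gen_image[of "{..<3}"] by blast
  have "\<exists>j<3. mdvd (sqfree (B j)) m"
  proof (rule top_key_dvd[OF _ _ h m])
    show "mdeg k < mdeg (sqfree (B j))" if "k \<in> keys (principal_minor E (B j) - single (sqfree (B j)) 1)" for j k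
      using mdeg_principal_minor_tail[OF fin that] .
    show "keys (sqfree (B i)) \<inter> keys (sqfree (B j)) = {}" if "i < 3" "j < 3" "i \<noteq> j" for i j
      using disjB[OF that] by (simp add: keys_sqfree fin)
  qed
  then obtain j where "B j \<subseteq> keys m" using mdvd_sqfree[OF fin] by blast
  then show False using x[of j] by blast
qed

text \<open>Reversing the path does not change its vertex set, and the sign is normalised away, so
  the value is independent of \<open>ori\<close>.\<close>

lemma dM_matching_of:
  assumes xs: "is_path xs" and ori: "orientation (matching_of xs) ori"
  shows "dM n E (matching_of xs) ori = principal_minor E ({0..<n} - set xs)"
proof -
  obtain ys where ys: "is_path ys" "set ys = set xs"
    "heads (matching_of xs) ori = {0..<n} - {hd ys}" "tails (matching_of xs) ori = {0..<n} - {last ys}"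
    using heads_tails_matching_of[OF assms] by blast
  then obtain c where "c = 1 \<or> c = -1"
    "minor n E (heads (matching_of xs) ori) (tails (matching_of xs) ori) = c * principal_minor E ({0..<n} - set xs)"
    using minor_path[OF ys(1)] by auto
  then show ?thesis using normalize_sign_principal_minor[of "{0..<n} - set xs" c E] by (simp add: dM_def)
qed

definition maximal_path :: "nat list \<Rightarrow> bool" where
  "maximal_path xs \<longleftrightarrow> is_path xs \<and> (\<forall>ys. is_path ys \<longrightarrow> \<not> set xs \<subset> set ys)"

text \<open>Minimal matchings correspond to maximal paths; \<open>orientation_exists\<close>
  guarantees that each of these paths contributes an element.\<close>

lemma basis_eq:
  "{dM n E M ori | M ori. M \<in> minimal_two_matchings n E (n - 1) \<and> orientation M ori} =
    {principal_minor E ({0..<n} - set xs) | xs. maximal_path xs}" (is "?L = ?R")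
proof
  show "?L \<subseteq> ?R"
  proof safe
    fix M ori assume M: "M \<in> minimal_two_matchings n E (n - 1)" "orientation M ori"
    then have "two_matching n E M" "card M = n - 1" by (auto simp: minimal_two_matchings_def)
    then obtain xs where xs: "is_path xs" "M = matching_of xs" using two_matching_imp_path by blast
    then have "maximal_path xs" using M minimal_matching_of_iff by (auto simp: maximal_path_def)
    then show "\<exists>xs. dM n E M ori = principal_minor E ({0..<n} - set xs) \<and> maximal_path xs"
      using dM_matching_of xs M by blast
  qed
  show "?R \<subseteq> ?L"
  proof safe
    fix xs assume max: "maximal_path xs"
    then have xs: "is_path xs" by (simp add: maximal_path_def)
    obtain ori where ori: "orientation (matching_of xs) ori" using orientation_exists[OF xs] by blast
    have "matching_of xs \<in> minimal_two_matchings n E (n - 1)"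
      using minimal_matching_of_iff[OF xs] max by (auto simp: maximal_path_def)
    then show "\<exists>M ori. principal_minor E ({0..<n} - set xs) = dM n E M ori \<and>
        M \<in> minimal_two_matchings n E (n - 1) \<and> orientation M ori"
      using dM_matching_of[OF xs ori] ori by metis
  qed
qed

lemma maximal_path_above:
  assumes "is_path ys"
  obtains xs where "maximal_path xs" "set ys \<subseteq> set xs"
proof -
  obtain xs where xs: "is_path xs" "set ys \<subseteq> set xs"
    and longest: "\<And>zs. is_path zs \<Longrightarrow> set ys \<subseteq> set zs \<Longrightarrow> length zs \<le> length xs"
    using longest_path[OF assms, of "\<lambda>xs. set ys \<subseteq> set xs"] by blast
  have "maximal_path xs"
    unfolding maximal_path_def
  proof (intro conjI allI impI notI xs(1))
    fix zs assume zs: "is_path zs" "set xs \<subset> set zs"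
    then have "length xs < length zs" by (simp add: length_path(1) xs psubset_card_mono)
    then show False using longest[of zs] zs xs by auto
  qed
  then show ?thesis using that xs by blast
qed

lemma principal_minor_path_in_minor_ideal:
  assumes xs: "is_path xs"
  shows "principal_minor E ({0..<n} - set xs) \<in> minor_ideal n E (n - 1)"
proof -
  let ?m = "minor n E ({0..<n} - {hd xs}) ({0..<n} - {last xs})"
  have "?m \<in> minor_ideal n E (n - 1)"
    unfolding minor_ideal_def using path_ends[OF xs]
    by (intro ideal_gen_base CollectI exI conjI) auto
  then have m: "?m \<in> minor_ideal n E (n - 1)" "- ?m \<in> minor_ideal n E (n - 1)"
    unfolding minor_ideal_def by (auto intro: ideal_gen_minus)
  obtain c where "c = 1 \<or> c = -1" "?m = c * principal_minor E ({0..<n} - set xs)"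
    using minor_path[OF xs] by blast
  then show ?thesis using m by auto
qed

text \<open>The variables absent from \<open>lp f\<close> lie on a path, hence on a maximal one, and
  the leading monomial belonging to that maximal path divides \<open>lp f\<close>.\<close>

lemma groebner_basis_minor_ideal:
  "groebner_basis {principal_minor E ({0..<n} - set xs) | xs. maximal_path xs} (minor_ideal n E (n - 1))"
    (is "groebner_basis ?B ?I")
proof -
  have "?B \<subseteq> principal_minor E ` Pow {0..<n}" by blast
  then have fin: "finite ?B" by (rule finite_subset) simp
  have sub: "?B \<subseteq> ?I" using principal_minor_path_in_minor_ideal by (auto simp: maximal_path_def)
  have nz: "0 \<notin> ?B"
  proof
    assume "0 \<in> ?B"
    then obtain xs where "principal_minor E ({0..<n} - set xs) = 0" by auto
    then show False using lookup_principal_minor_top[of "{0..<n} - set xs" E] by simp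
  qed
  have "lt f \<in> ideal_gen (lt ` ?B)" if f: "f \<in> ?I" for f
  proof (cases "f = 0")
    case True
    \<comment> \<open>\<open>lp 0\<close> is unspecified, but every coefficient of \<open>0\<close>
      vanishes, so \<open>lt 0 = 0\<close>.\<close>
    then show ?thesis by (simp add: lt_def lc_def ideal_gen_zero)
  next
    case False
    then obtain ys where ys: "is_path ys" "{0..<n} - set ys \<subseteq> keys (lp f)"
      using top_key_covered_by_path[OF f lp_in_keys[OF False]] by blast
    then obtain xs where xs: "maximal_path xs" "set ys \<subseteq> set xs" using maximal_path_above by blast
    let ?S = "{0..<n} - set xs"
    have "?S \<subseteq> keys (lp f)" using ys xs by blast
    then obtain k where k: "lp f = k + sqfree ?S"
      using mdvd_sqfree[of ?S "lp f"] by (auto simp: mdvd_iff)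
    have "lt (principal_minor E ?S) = single (sqfree ?S) 1" by (simp add: lt_def lp_principal_minor lc_principal_minor)
    then have "lt f = single k (lc f) * lt (principal_minor E ?S)"
      unfolding lt_def[of f] k by (simp add: mult_single)
    moreover have "lt (principal_minor E ?S) \<in> ideal_gen (lt ` ?B)"
      using xs by (intro ideal_gen_base imageI) blast
    ultimately show ?thesis by (simp only: ideal_gen_mult)
  qed
  then have "ideal_gen (lt ` ?I) \<subseteq> ideal_gen (lt ` ?B)" by (intro ideal_gen_minimal) blast
  moreover have "ideal_gen (lt ` ?B) \<subseteq> ideal_gen (lt ` ?I)" using sub by (intro ideal_gen_mono) blast
  ultimately show ?thesis using fin sub nz unfolding groebner_basis_def by blast
qed

text \<open>All monomials of an element involve only variables off its path. A divisibility would
  thus force one maximal path into another, and maximality makes their vertex sets, hence the two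
  elements, equal.\<close>

lemma reduced_groebner_basis_minor_ideal:
  "reduced_groebner_basis {principal_minor E ({0..<n} - set xs) | xs. maximal_path xs} (minor_ideal n E (n - 1))"
  unfolding reduced_groebner_basis_def
proof (intro conjI groebner_basis_minor_ideal ballI impI)
  fix b assume "b \<in> {principal_minor E ({0..<n} - set xs) | xs. maximal_path xs}"
  then show "lc b = 1" using lc_principal_minor by auto
next
  fix b b' m assume b: "b \<in> {principal_minor E ({0..<n} - set xs) | xs. maximal_path xs}"
    and b': "b' \<in> {principal_minor E ({0..<n} - set xs) | xs. maximal_path xs}"
    and ne: "b' \<noteq> b" and m: "m \<in> keys b"
  obtain xs where xs: "maximal_path xs" "b = principal_minor E ({0..<n} - set xs)" using b by blast
  obtain ys where ys: "maximal_path ys" "b' = principal_minor E ({0..<n} - set ys)" using b' by blast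
  show "\<not> mdvd (lp b') m"
  proof
    assume "mdvd (lp b') m"
    then have "{0..<n} - set ys \<subseteq> keys m" using ys(2) by (simp add: lp_principal_minor mdvd_sqfree)
    also have "keys m \<subseteq> {0..<n} - set xs" using m xs(2) keys_principal_minor_subset by blast
    finally have "set xs \<subseteq> set ys" using xs(1) by (auto simp: maximal_path_def is_path_def)
    then have "set xs = set ys" using xs(1) ys(1) by (auto simp: maximal_path_def)
    then show False using ne xs(2) ys(2) by simp
  qed
qed

end

theorem theorem4p8:
  fixes n :: nat and E :: "nat set set"
  assumes "is_tree n E"
  shows "reduced_groebner_basis
           {dM n E M ori | M ori. M \<in> minimal_two_matchings n E (n - 1) \<and> orientation M ori}
           (minor_ideal n E (n - 1))"
proof -
  interpret finite_tree n E by unfold_locales (rule assms)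
  show ?thesis unfolding basis_eq by (rule reduced_groebner_basis_minor_ideal)
qed

end
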